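(* Let $G$ be an unmixed bipartite graph on the vertex set $\{x_1,\ldots,x_n\}\cup\{y_1,\ldots,y_n\}$ with $\{x_i,y_i\}\in E(G)$ for all $i$, let $\mathcal{L}_G$ be its lattice of vertex covers, and let $H_{\mathcal{L}_G}=(u_p : p\in\mathcal{L}_G)\subseteq R=K[x_1,\ldots,x_n,y_1,\ldots,y_n]$. The minimal multigraded free resolution $\mathbb{F}$ of $H_{\mathcal{L}_G}$ in which $\mathbb{F}_i$ has a basis consisting of the elements $b(p;S)$ with $p\in\mathcal{L}_G$, $S\subseteq N(p)$, $|S|=i$, where $b(p;S)$ has multidegree $\operatorname{lcm}(u_p,\, u_q : q\in S)$, can be chosen so that for any $p\in\mathcal{L}_G$ and $S\subseteq N(p)$ we have $$\partial(b(p;S))=\sum_{q\in S}(-1)^{\sigma(q;S)}\bigl(Y_{S_q}\,b(p;S\setminus\{q\})-X_{p\setminus q}\,b(q;\,q\wedge(S\setminus\{q\}))\bigr).$$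
   Context: All graphs are finite and have no isolated vertices. A graph is unmixed if all its minimal vertex covers have the same cardinality. An unmixed bipartite graph has bipartition classes of equal size and a perfect matching, so its vertices can be labelled $x_1,\dots,x_n$ and $y_1,\dots,y_n$ (the two classes) with $\{x_i,y_i\}\in E(G)$ for all $i$; every minimal vertex cover then contains exactly one of $x_i,y_i$ for each $i$. Put $\mathcal{L}_G=\{C\cap\{x_1,\dots,x_n\} : C \text{ is a minimal vertex cover of } G\}$, viewed also as a family of subsets of $[n]$ by identifying $x_i$ with $i$. It is known that $\mathcal{L}_G$ is a sublattice of the Boolean lattice of all subsets, containing $\emptyset$ and the whole set; thus $\wedge$ is intersection and $\vee$ is union. $K$ is a field. For $p\in\mathcal{L}_G$ let $u_p=\prod_{i\in p}x_i\prod_{j\in[n]\setminus p}y_j$. $N(p)$ denotes the set of lower neighbors of $p$ in $\mathcal{L}_G$, i.e. the elements of $\mathcal{L}_G$ covered by $p$. "Multigraded" refers to the $\mathbb{Z}^{2n}$-grading of $R$. The basis elements $b(p;S)$ are indexed by an element $p\in\mathcal{L}_G$ and a set $S\subseteq N(p)$; a resolution $\mathbb{F}$ with such a basis exists. $\partial$ denotes the differential of $\mathbb{F}$. The rank of $p\in\mathcal{L}_G$ is the maximal length of chains descending from $p$. The partial order by rank on $\mathcal{L}_G$ is extended to a total order $\prec$. For $S\subseteq\mathcal{L}_G$ and $q\in S$ let $\sigma(q;S)=|\{r\in S: r\prec q\}|$. For $S\subseteq N(p)$ and $q\in S$ let $$X_{p\setminus q}=\prod_{i\in p\setminus q}x_i,\qquad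 Y_{S_q}=\prod_{i\in(\bigwedge_{r\in S\setminus\{q\}}r)\setminus q}y_i ,$$ where the meet over the empty set is taken to be $p$. For $q\in S\subseteq N(p)$, $q\wedge(S\setminus\{q\})=\{q\wedge r: r\in S\setminus\{q\}\}$, which is a subset of $N(q)$.
   Formalization: The total order ≺ extending the rank order is chosen along with the resolution rather than arbitrary; for an arbitrary extension the formula can violate ∂∘∂=0 (three disjoint edges, p=123, 13≺23 but 2≺1, char K≠2). *)

theory Defs
  imports Complex_Main "HOL-Library.Poly_Mapping"
begin

section \<open>Unmixed bipartite graphs and their vertex covers\<close>

text \<open>
  The index set \<open>[n]\<close> is an arbitrary finite type \<open>'n\<close>. The vertices \<open>x\<^sub>i\<close> and \<open>y\<^sub>i\<close> are
  \<open>Inl i\<close> and \<open>Inr i\<close>, so that \<open>'n + 'n\<close> serves both as vertex set of the graph and as set of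
  variables of the polynomial ring. A graph is given by its set of edges.
\<close>

definition bipartite_graph :: "('n + 'n) set set \<Rightarrow> bool" where
  "bipartite_graph E \<longleftrightarrow> (\<forall>e\<in>E. \<exists>i j. e = {Inl i, Inr j})"

definition vertex_cover :: "'v set set \<Rightarrow> 'v set \<Rightarrow> bool" where
  "vertex_cover E C \<longleftrightarrow> (\<forall>e\<in>E. e \<inter> C \<noteq> {})"

definition minimal_vertex_cover :: "'v set set \<Rightarrow> 'v set \<Rightarrow> bool" where
  "minimal_vertex_cover E C \<longleftrightarrow> vertex_cover E C \<and> (\<forall>D. D \<subset> C \<longrightarrow> \<not> vertex_cover E D)"

definition unmixed :: "'v set set \<Rightarrow> bool" where
  "unmixed E \<longleftrightarrow>
     (\<forall>C D. minimal_vertex_cover E C \<longrightarrow> minimal_vertex_cover E D \<longrightarrow> card C = card D)"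

definition cover_lattice :: "('n + 'n) set set \<Rightarrow> 'n set set" where
  "cover_lattice E = {{i. Inl i \<in> C} | C. minimal_vertex_cover E C}"

definition lower_neighbors :: "'n set set \<Rightarrow> 'n set \<Rightarrow> 'n set set" where
  "lower_neighbors L p = {q \<in> L. q \<subset> p \<and> \<not> (\<exists>r\<in>L. q \<subset> r \<and> r \<subset> p)}"

text \<open>The length of a chain with \<open>k + 1\<close> elements is \<open>k\<close>.\<close>

definition lattice_rank :: "'n set set \<Rightarrow> 'n set \<Rightarrow> nat" where
  "lattice_rank L p = Max {card C - 1 | C. subset.chain L C \<and> p \<in> C \<and> (\<forall>q\<in>C. q \<subseteq> p)}"

definition total_extension_of_rank :: "'n set set \<Rightarrow> ('n set \<times> 'n set) set \<Rightarrow> bool" where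
  "total_extension_of_rank L ord \<longleftrightarrow> strict_linear_order_on L ord \<and>
     (\<forall>p\<in>L. \<forall>q\<in>L. lattice_rank L p < lattice_rank L q \<longrightarrow> (p, q) \<in> ord)"

definition position :: "('n set \<times> 'n set) set \<Rightarrow> 'n set \<Rightarrow> 'n set set \<Rightarrow> nat" where
  "position ord q S = card {r \<in> S. (r, q) \<in> ord}"

text \<open>The meet of \<open>T\<close>, a set of elements below \<open>p\<close>, where the empty meet is \<open>p\<close>.\<close>

definition meet_below :: "'n set \<Rightarrow> 'n set set \<Rightarrow> 'n set" where
  "meet_below p T = (if T = {} then p else \<Inter> T)"


section \<open>The polynomial ring and multigraded modules\<close>

type_synonym ('v, 'k) mpoly = "('v \<Rightarrow>\<^sub>0 nat) \<Rightarrow>\<^sub>0 'k"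

type_synonym 'v multidegree = "'v \<Rightarrow>\<^sub>0 int"

definition var :: "'v \<Rightarrow> ('v, 'k::field) mpoly" where
  "var v = Poly_Mapping.single (Poly_Mapping.single v 1) 1"

definition multidegree :: "('v \<Rightarrow>\<^sub>0 nat) \<Rightarrow> 'v multidegree" where
  "multidegree e = Poly_Mapping.map int e"

definition poly_component :: "'v multidegree \<Rightarrow> ('v, 'k::field) mpoly set" where
  "poly_component a = {f. \<forall>e\<in>Poly_Mapping.keys f. multidegree e = a}"

definition is_lcm :: "'r::comm_ring_1 set \<Rightarrow> 'r \<Rightarrow> bool" where
  "is_lcm A m \<longleftrightarrow> (\<forall>a\<in>A. a dvd m) \<and> (\<forall>c. (\<forall>a\<in>A. a dvd c) \<longrightarrow> m dvd c)"

definition ideal_generated :: "'r::comm_ring_1 set \<Rightarrow> 'r set" where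
  "ideal_generated A = module.span (*) A"

text \<open>
  A module is a submodule \<open>M\<close> of an ambient type \<open>'m\<close> with scalar multiplication \<open>s\<close>, and its
  multigrading is the family \<open>gr\<close> of homogeneous components. The last clause below says that \<open>M\<close> is
  the direct sum of these components.
\<close>

definition multigraded_module ::
  "(('v, 'k::field) mpoly \<Rightarrow> 'm::ab_group_add \<Rightarrow> 'm) \<Rightarrow> 'm set \<Rightarrow> ('v multidegree \<Rightarrow> 'm set) \<Rightarrow> bool"
  where
  "multigraded_module s M gr \<longleftrightarrow>
     module s \<and> module.subspace s M \<and>
     (\<forall>a. gr a \<subseteq> M \<and> 0 \<in> gr a \<and> (\<forall>x\<in>gr a. \<forall>y\<in>gr a. x + y \<in> gr a)) \<and>
     (\<forall>a c. \<forall>f\<in>poly_component a. \<forall>x\<in>gr c. s f x \<in> gr (a + c)) \<and>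
     (\<forall>x\<in>M. \<exists>!g. (\<forall>a. Poly_Mapping.lookup g a \<in> gr a) \<and>
        x = (\<Sum>a\<in>Poly_Mapping.keys g. Poly_Mapping.lookup g a))"

definition multigraded_hom ::
  "(('v, 'k::field) mpoly \<Rightarrow> 'm::ab_group_add \<Rightarrow> 'm) \<Rightarrow> 'm set \<Rightarrow> ('v multidegree \<Rightarrow> 'm set) \<Rightarrow>
   (('v, 'k) mpoly \<Rightarrow> 'l::ab_group_add \<Rightarrow> 'l) \<Rightarrow> 'l set \<Rightarrow> ('v multidegree \<Rightarrow> 'l set) \<Rightarrow>
   ('m \<Rightarrow> 'l) \<Rightarrow> bool" where
  "multigraded_hom s M gr t N gr' h \<longleftrightarrow>
     h ` M \<subseteq> N \<and>
     (\<forall>x\<in>M. \<forall>y\<in>M. h (x + y) = h x + h y) \<and>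
     (\<forall>f. \<forall>x\<in>M. h (s f x) = t f (h x)) \<and>
     (\<forall>a. h ` gr a \<subseteq> gr' a)"

definition is_basis ::
  "('r::comm_ring_1 \<Rightarrow> 'm::ab_group_add \<Rightarrow> 'm) \<Rightarrow> 'm set \<Rightarrow> 'm set \<Rightarrow> bool" where
  "is_basis s M B \<longleftrightarrow> \<not> module.dependent s B \<and> module.span s B = M"

definition multigraded_free_module ::
  "(('v, 'k::field) mpoly \<Rightarrow> 'm::ab_group_add \<Rightarrow> 'm) \<Rightarrow> 'm set \<Rightarrow> ('v multidegree \<Rightarrow> 'm set) \<Rightarrow> bool"
  where
  "multigraded_free_module s M gr \<longleftrightarrow>
     multigraded_module s M gr \<and> (\<exists>B. is_basis s M B \<and> (\<forall>x\<in>B. \<exists>a. x \<in> gr a))"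

text \<open>
  The differential is a family \<open>d\<close> with \<open>d i : F i \<rightarrow> F (i - 1)\<close>, where \<open>F (-1) = 0\<close>, so \<open>d 0\<close> is
  zero on \<open>F 0\<close>; \<open>\<epsilon> : F 0 \<rightarrow> M\<close> is the augmentation.
\<close>

definition multigraded_free_resolution ::
  "(('v, 'k::field) mpoly \<Rightarrow> 'm::ab_group_add \<Rightarrow> 'm) \<Rightarrow> (nat \<Rightarrow> 'm set) \<Rightarrow>
   (nat \<Rightarrow> 'v multidegree \<Rightarrow> 'm set) \<Rightarrow> (nat \<Rightarrow> 'm \<Rightarrow> 'm) \<Rightarrow> ('m \<Rightarrow> 'l) \<Rightarrow>
   (('v, 'k) mpoly \<Rightarrow> 'l::ab_group_add \<Rightarrow> 'l) \<Rightarrow> 'l set \<Rightarrow> ('v multidegree \<Rightarrow> 'l set) \<Rightarrow> bool" where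
  "multigraded_free_resolution s F gr d \<epsilon> t M grM \<longleftrightarrow>
     multigraded_module t M grM \<and>
     (\<forall>i. multigraded_free_module s (F i) (gr i)) \<and>
     multigraded_hom s (F 0) (gr 0) t M grM \<epsilon> \<and>
     (\<forall>i. multigraded_hom s (F (Suc i)) (gr (Suc i)) s (F i) (gr i) (d (Suc i))) \<and>
     (\<forall>x\<in>F 0. d 0 x = 0) \<and>
     \<epsilon> ` F 0 = M \<and>
     {x \<in> F 0. \<epsilon> x = 0} = d 1 ` F 1 \<and>
     (\<forall>i. {x \<in> F (Suc i). d (Suc i) x = 0} = d (Suc (Suc i)) ` F (Suc (Suc i)))"

text \<open>Minimality: \<open>d (F (i + 1)) \<subseteq> \<mm> F i\<close> for the ideal \<open>\<mm>\<close> generated by the variables.\<close>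

definition minimal_multigraded_free_resolution ::
  "(('v, 'k::field) mpoly \<Rightarrow> 'm::ab_group_add \<Rightarrow> 'm) \<Rightarrow> (nat \<Rightarrow> 'm set) \<Rightarrow>
   (nat \<Rightarrow> 'v multidegree \<Rightarrow> 'm set) \<Rightarrow> (nat \<Rightarrow> 'm \<Rightarrow> 'm) \<Rightarrow> ('m \<Rightarrow> 'l) \<Rightarrow>
   (('v, 'k) mpoly \<Rightarrow> 'l::ab_group_add \<Rightarrow> 'l) \<Rightarrow> 'l set \<Rightarrow> ('v multidegree \<Rightarrow> 'l set) \<Rightarrow> bool" where
  "minimal_multigraded_free_resolution s F gr d \<epsilon> t M grM \<longleftrightarrow>
     multigraded_free_resolution s F gr d \<epsilon> t M grM \<and>
     (\<forall>i. d (Suc i) ` F (Suc i) \<subseteq> module.span s {s (var v) x | v x. x \<in> F i})"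

text \<open>
  The modules of the resolution are realised as submodules of free modules \<open>R\<^bsup>(I)\<^esup>\<close>, that is, of the
  finitely supported functions on \<open>I\<close> with the following scalar multiplication.
\<close>

definition free_scale :: "'r::comm_ring_1 \<Rightarrow> ('i \<Rightarrow>\<^sub>0 'r) \<Rightarrow> ('i \<Rightarrow>\<^sub>0 'r)" where
  "free_scale c f = Poly_Mapping.map ((*) c) f"

lemma lookup_free_scale [simp]:
  "Poly_Mapping.lookup (free_scale c f) i = c * Poly_Mapping.lookup f i"
  by (simp add: free_scale_def Poly_Mapping.map.rep_eq when_def)

lemma module_free_scale: "module free_scale"
  by unfold_locales (auto intro!: poly_mapping_eqI simp: lookup_add algebra_simps)


section \<open>The ideal of the lattice and the coefficients of the differential\<close>

definition cover_monomial :: "'n::finite set \<Rightarrow> ('n + 'n, 'k::field) mpoly" where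
  "cover_monomial p = (\<Prod>i\<in>p. var (Inl i)) * (\<Prod>j\<in>UNIV - p. var (Inr j))"

definition cover_ideal :: "'n::finite set set \<Rightarrow> ('n + 'n, 'k::field) mpoly set" where
  "cover_ideal L = ideal_generated (cover_monomial ` L)"

definition X_coeff :: "'n::finite set \<Rightarrow> 'n set \<Rightarrow> ('n + 'n, 'k::field) mpoly" where
  "X_coeff p q = (\<Prod>i\<in>p - q. var (Inl i))"

definition Y_coeff :: "'n::finite set \<Rightarrow> 'n set set \<Rightarrow> 'n set \<Rightarrow> ('n + 'n, 'k::field) mpoly" where
  "Y_coeff p S q = (\<Prod>i\<in>meet_below p (S - {q}) - q. var (Inr i))"

definition basis_index :: "'n set set \<Rightarrow> nat \<Rightarrow> ('n set \<times> 'n set set) set" where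
  "basis_index L i = {(p, S). p \<in> L \<and> S \<subseteq> lower_neighbors L p \<and> card S = i}"

text \<open>
  \<open>b\<close> supplies bases of all \<open>F i\<close>, with \<open>b p S\<close> homogeneous of multidegree
  \<open>lcm (u\<^sub>p, u\<^sub>q : q \<in> S)\<close>; \<open>e\<close> is the exponent of that monomial.
\<close>

definition lattice_basis ::
  "'n::finite set set \<Rightarrow> (('n + 'n, 'k::field) mpoly \<Rightarrow> 'm::ab_group_add \<Rightarrow> 'm) \<Rightarrow> (nat \<Rightarrow> 'm set) \<Rightarrow>
   (nat \<Rightarrow> ('n + 'n) multidegree \<Rightarrow> 'm set) \<Rightarrow> ('n set \<Rightarrow> 'n set set \<Rightarrow> 'm) \<Rightarrow> bool" where
  "lattice_basis L s F gr b \<longleftrightarrow>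
     (\<forall>i. inj_on (\<lambda>(p, S). b p S) (basis_index L i) \<and>
          is_basis s (F i) ((\<lambda>(p, S). b p S) ` basis_index L i)) \<and>
     (\<forall>p\<in>L. \<forall>S\<subseteq>lower_neighbors L p. \<exists>e.
        is_lcm (cover_monomial ` insert p S :: ('n + 'n, 'k) mpoly set) (Poly_Mapping.single e 1) \<and>
        b p S \<in> gr (card S) (multidegree e))"

text \<open>
  The order \<open>ord\<close> has to be chosen, like the resolution: the signs below give \<open>d \<circ> d = 0\<close> only if
  \<open>q \<inter> r \<prec> q \<inter> s \<longleftrightarrow> r \<prec> s\<close> for distinct lower neighbors \<open>q, r, s\<close> of the same element (unless \<open>K\<close> has
  characteristic 2), which an order that is arbitrary within the ranks need not satisfy.
\<close>

end

theory Submission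
  imports Defs "HOL-Library.Nat_Bijection"
begin

text \<open>
  Minimal vertex covers correspond to the sets \<open>p\<close> closed under the edge relation, so the lattice is
  a sublattice of the Boolean lattice and the sets \<open>p - q\<close>, for \<open>q\<close> a lower neighbor of \<open>p\<close>, are
  pairwise disjoint. Hence \<open>Y_coeff p S q\<close> is the monomial \<open>y\<^bsub>p - q\<^esub>\<close>, independent of \<open>S\<close>, and
  \<open>\<partial> \<circ> \<partial> = 0\<close> is the usual cancellation of signs, provided that the order is compatible with
  the meet with \<open>q\<close>. For exactness, take a cycle and the greatest \<open>p\<close> in its support: its component
  at \<open>p\<close> is a cycle of the Koszul complex of the monomials \<open>y\<^bsub>p - q\<^esub>\<close>, which have disjoint supports
  and thus form a regular sequence; subtracting a boundary moves the cycle to smaller elements.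
\<close>

text \<open>The signs are the obstacle: ties within a rank cannot be broken at will. The order is
  therefore induced by an injective number-valued key that is modular,
  \<open>key (p \<union> q) + key (p \<inter> q) = key p + key q\<close>. Two lower neighbors
  \<open>q\<close>, \<open>r\<close> of \<open>p\<close> have union \<open>p\<close>, so passing
  from \<open>r\<close> to \<open>q \<inter> r\<close> changes keys by the constant
  \<open>key q - key p\<close> and no position changes. Such a key exists because the rank counts
  the smallest lattice members around the points of \<open>p\<close>, and counting is modular. In
  the exactness argument the \<open>X\<close>-terms of the differential go strictly down, so at a
  greatest \<open>p\<close> only \<open>Y\<close>-terms arrive. The cycle condition never involves
  the coefficient at \<open>b(p; {})\<close>; there the vanishing of the augmentation has to supply
  that each term is divisible by some Koszul monomial. Exactness of the Koszul complex comes from an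
  explicit homotopy on terms, which also controls the support of the preimage and so keeps it in the
  right homological degree.\<close>

abbreviation lookup :: "('a \<Rightarrow>\<^sub>0 'b::zero) \<Rightarrow> 'a \<Rightarrow> 'b" where
  "lookup \<equiv> Poly_Mapping.lookup"

abbreviation keys :: "('a \<Rightarrow>\<^sub>0 'b::zero) \<Rightarrow> 'a set" where
  "keys \<equiv> Poly_Mapping.keys"

section \<open>Monomials\<close>

definition exp_le :: "('v \<Rightarrow>\<^sub>0 nat) \<Rightarrow> ('v \<Rightarrow>\<^sub>0 nat) \<Rightarrow> bool"  (infix \<open>\<preceq>\<close> 50) where
  "e \<preceq> k \<longleftrightarrow> (\<forall>v. lookup e v \<le> lookup k v)"

lemma exp_le_add [simp]: "e \<preceq> e + k"
  by (simp add: exp_le_def lookup_add)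

lemma exp_le_imp_add_diff: "e \<preceq> k \<Longrightarrow> e + (k - e) = k"
  by (rule poly_mapping_eqI) (simp add: exp_le_def lookup_add lookup_minus)

lemma lookup_monomial_mult_add:
  fixes f :: "('v, 'k::field) mpoly"
  shows "lookup (Poly_Mapping.single e c * f) (e + k) = c * lookup f k"
proof -
  have "(c * (lookup f q when k = q)) = (c * lookup f q when q = k)" for q
    by (auto simp: when_def)
  then show ?thesis
    by (simp add: lookup_mult lookup_single when_mult)
qed

lemma lookup_monomial_mult:
  fixes f :: "('v, 'k::field) mpoly"
  shows "lookup (Poly_Mapping.single e c * f) k = (if e \<preceq> k then c * lookup f (k - e) else 0)"
proof (cases "e \<preceq> k")
  case True
  then show ?thesis
    using lookup_monomial_mult_add[of e c f "k - e"] by (simp add: exp_le_imp_add_diff)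
next
  case False
  then have "k \<notin> keys (Poly_Mapping.single e c * f)"
    using keys_mult[of "Poly_Mapping.single e c" f] exp_le_add by (fastforce split: if_splits)
  then show ?thesis
    using False by (simp add: in_keys_iff)
qed

lemma lookup_sign_mult:
  fixes f :: "('v, 'k::field) mpoly"
  shows "lookup ((-1) ^ n * f) k = (-1) ^ n * lookup f k"
  by (induction n) simp_all

lemma sum_monomials:
  fixes f :: "('v, 'k::field) mpoly"
  shows "(\<Sum>k\<in>keys f. Poly_Mapping.single k (lookup f k)) = f"
  by (rule poly_mapping_eqI) (simp add: lookup_sum lookup_single when_def sum.If_cases in_keys_iff)

text \<open>Divisibility by a monomial can be tested term by term; this turns least common multiples
  into unions of supports in \<open>is_lcm_basis_degree\<close>.\<close>

lemma monomial_dvd_iff: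
  fixes f :: "('v, 'k::field) mpoly"
  shows "Poly_Mapping.single e 1 dvd f \<longleftrightarrow> (\<forall>k\<in>keys f. e \<preceq> k)"
proof
  assume "Poly_Mapping.single e 1 dvd f"
  then show "\<forall>k\<in>keys f. e \<preceq> k"
    by (auto elim!: dvdE simp: in_keys_iff lookup_monomial_mult split: if_splits)
next
  assume *: "\<forall>k\<in>keys f. e \<preceq> k"
  have "Poly_Mapping.single e 1 dvd (\<Sum>k\<in>keys f. Poly_Mapping.single k (lookup f k))"
  proof (rule dvd_sum)
    fix k assume "k \<in> keys f"
    then have "Poly_Mapping.single k (lookup f k) =
        Poly_Mapping.single e 1 * Poly_Mapping.single (k - e) (lookup f k)"
      using * by (simp add: mult_single exp_le_imp_add_diff)
    then show "Poly_Mapping.single e 1 dvd Poly_Mapping.single k (lookup f k)"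
      by simp
  qed
  then show "Poly_Mapping.single e 1 dvd f"
    by (simp add: sum_monomials)
qed

section \<open>Square-free monomials\<close>

definition sqfree_exp :: "'v::finite set \<Rightarrow> ('v \<Rightarrow>\<^sub>0 nat)" where
  "sqfree_exp A = Abs_poly_mapping (\<lambda>v. if v \<in> A then 1 else 0)"

lemma lookup_sqfree_exp [simp]: "lookup (sqfree_exp A) v = (if v \<in> A then 1 else 0)"
  unfolding sqfree_exp_def by (subst lookup_Abs_poly_mapping) auto

lemma sqfree_exp_le_iff: "sqfree_exp A \<preceq> k \<longleftrightarrow> (\<forall>v\<in>A. 0 < lookup k v)"
  by (auto simp: exp_le_def Suc_le_eq)

lemma sqfree_exp_Un: "A \<inter> B = {} \<Longrightarrow> sqfree_exp (A \<union> B) = sqfree_exp A + sqfree_exp B"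
  by (rule poly_mapping_eqI) (auto simp: lookup_add)

abbreviation sqfree_monomial :: "'v::finite set \<Rightarrow> ('v, 'k::field) mpoly" where
  "sqfree_monomial A \<equiv> Poly_Mapping.single (sqfree_exp A) 1"

lemma prod_var_eq_sqfree_monomial:
  fixes f :: "'n::finite \<Rightarrow> 'v::finite"
  assumes "inj f"
  shows "(\<Prod>i\<in>A. var (f i)) = sqfree_monomial (f ` A)"
proof -
  have "finite A" by simp
  then show ?thesis
  proof induction
    case empty
    have "sqfree_exp ({} :: 'v set) = 0"
      by (rule poly_mapping_eqI) simp
    then show ?case by simp
  next
    case (insert i A)
    have "Poly_Mapping.single (f i) 1 = sqfree_exp {f i}"
      by (rule poly_mapping_eqI) (simp add: lookup_single when_def)
    moreover have "{f i} \<inter> f ` A = {}"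
      using insert.hyps assms by (auto dest: injD)
    ultimately show ?case
      using insert sqfree_exp_Un[of "{f i}" "f ` A"] by (simp add: var_def mult_single)
  qed
qed

section \<open>Koszul complexes of monomials with disjoint supports\<close>

text \<open>The position from the statement, for the order induced by a key. The index type is left
  free so that the Koszul lemma does not mention lattices.\<close>

definition pos :: "('c \<Rightarrow> nat) \<Rightarrow> 'c \<Rightarrow> 'c set \<Rightarrow> nat" where
  "pos key q S = card {r \<in> S. key r < key q}"

text \<open>Deleting \<open>q\<close> moves exactly the elements after \<open>q\<close> by one
  place; the sign cancellations in the homotopy and in the square of the differential rest on this
  unit shift.\<close>

lemma pos_remove:
  assumes "finite S" "q \<in> S"
  shows "pos key r S = pos key r (S - {q}) + (if key q < key r then 1 else 0)"
proof (cases "key q < key r")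
  case True
  then have "{s \<in> S. key s < key r} = insert q {s \<in> S - {q}. key s < key r}"
    using assms by auto
  then show ?thesis
    using True assms by (simp add: pos_def)
next
  case False
  then have "{s \<in> S. key s < key r} = {s \<in> S - {q}. key s < key r}"
    by auto
  then show ?thesis
    using False by (simp add: pos_def)
qed

text \<open>The contracting homotopy inserts the least \<open>c\<close> whose monomial \<open>e c\<close> divides a given term.\<close>

lemma koszul_exact:
  fixes N :: "'c set" and key :: "'c \<Rightarrow> nat" and e :: "'c \<Rightarrow> ('v \<Rightarrow>\<^sub>0 nat)"
    and z :: "'c set \<Rightarrow> ('v, 'k::field) mpoly"
  assumes fin: "finite N" and inj: "inj_on key N"
    and disj: "\<And>c c' v. c \<in> N \<Longrightarrow> c' \<in> N \<Longrightarrow> c \<noteq> c' \<Longrightarrow> lookup (e c) v = 0 \<or> lookup (e c') v = 0"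
    and cycle: "\<And>B. B \<subseteq> N \<Longrightarrow>
      (\<Sum>c\<in>N - B. (-1) ^ pos key c (insert c B) * (Poly_Mapping.single (e c) 1 * z (insert c B))) = 0"
    and deg0: "\<And>m. m \<in> keys (z {}) \<Longrightarrow> \<exists>c\<in>N. e c \<preceq> m"
  shows "\<exists>w. (\<forall>A\<subseteq>N. z A =
        (\<Sum>c\<in>N - A. (-1) ^ pos key c (insert c A) * (Poly_Mapping.single (e c) 1 * w (insert c A)))) \<and>
      (\<forall>B. (\<forall>c\<in>B. z (B - {c}) = 0) \<longrightarrow> w B = 0)"
proof -
  define low where "low B = arg_min_on key B" for B
  have low: "low B \<in> B" "\<And>c. c \<in> B \<Longrightarrow> c \<noteq> low B \<Longrightarrow> key (low B) < key c"
    if "B \<noteq> {}" "B \<subseteq> N" for B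
  proof -
    have f: "finite B"
      using that fin finite_subset by blast
    show l: "low B \<in> B"
      unfolding low_def using f that by (intro arg_min_if_finite)
    fix c assume "c \<in> B" "c \<noteq> low B"
    moreover have "key (low B) \<le> key c"
      unfolding low_def using f that \<open>c \<in> B\<close> by (intro arg_min_least)
    ultimately show "key (low B) < key c"
      using inj l that by (metis inj_onD le_neq_implies_less subsetD)
  qed
  \<comment> \<open>The homotopy read backwards: the term \<open>m\<close> of \<open>w B\<close>
    comes from the term \<open>e (low B) + m\<close> of \<open>z (B - {low B})\<close>, into which
    \<open>low B\<close> is inserted. The first branch discards it if the monomial of a smaller
    index divides \<open>m\<close>, since that index would have been inserted instead.\<close>
  define w :: "'c set \<Rightarrow> ('v, 'k) mpoly" where
    "w B = (if B = {} \<or> \<not> B \<subseteq> N then 0 else Abs_poly_mapping (\<lambda>m.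
       if \<exists>c\<in>N. key c < key (low B) \<and> e c \<preceq> m then 0
       else lookup (z (B - {low B})) (e (low B) + m)))" for B
  have w: "lookup (w B) m = (if \<exists>c\<in>N. key c < key (low B) \<and> e c \<preceq> m then 0
       else lookup (z (B - {low B})) (e (low B) + m))" if "B \<noteq> {}" "B \<subseteq> N" for B m
  proof -
    have "finite {m. lookup (z (B - {low B})) (e (low B) + m) \<noteq> 0}"
      by (rule finite_subset[OF _ finite_vimageI[of "keys (z (B - {low B}))" "\<lambda>m. e (low B) + m"]])
        (auto simp: in_keys_iff inj_on_def)
    then have "finite {m. (if \<exists>c\<in>N. key c < key (low B) \<and> e c \<preceq> m then 0
       else lookup (z (B - {low B})) (e (low B) + m)) \<noteq> 0}"
      by (rule rev_finite_subset) auto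
    then show ?thesis
      using that by (simp add: w_def)
  qed
  have "lookup (z A) m = lookup (\<Sum>c\<in>N - A. (-1) ^ pos key c (insert c A) *
      (Poly_Mapping.single (e c) 1 * w (insert c A))) m" if A: "A \<subseteq> N" for A m
  proof -
    let ?t = "\<lambda>c. (-1) ^ pos key c (insert c A) * (if e c \<preceq> m then lookup (w (insert c A)) (m - e c) else 0)"
    have rhs: "lookup (\<Sum>c\<in>N - A. (-1) ^ pos key c (insert c A) *
      (Poly_Mapping.single (e c) 1 * w (insert c A))) m = (\<Sum>c\<in>N - A. ?t c)"
      unfolding lookup_sum by (intro sum.cong refl) (simp add: lookup_sign_mult lookup_monomial_mult)
    \<comment> \<open>The indices in \<open>A\<close> and those whose monomial divides
      \<open>m\<close>. By disjointness of supports \<open>T\<close> does not change when an index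
      moves from one role to the other, so its least element \<open>c0\<close> governs all terms
      compared here.\<close>
    define T where "T = A \<union> {c \<in> N. e c \<preceq> m}"
    have TN: "T \<subseteq> N"
      using A by (auto simp: T_def)
    have transfer: "e c \<preceq> m - e c' \<longleftrightarrow> e c \<preceq> m"
      if "c \<in> N" "c' \<in> N" "c \<noteq> c'" for c c'
    proof -
      have "lookup (e c) v \<le> lookup m v - lookup (e c') v \<longleftrightarrow> lookup (e c) v \<le> lookup m v" for v
        using disj[OF that, of v] by auto
      then show ?thesis
        by (simp add: exp_le_def lookup_minus)
    qed
    show ?thesis
    proof (cases "T = {}")
      \<comment> \<open>Empty \<open>T\<close> forces \<open>A = {}\<close>. The cycle condition
        never involves \<open>z {}\<close>; \<open>deg0\<close> excludes such terms.\<close>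
      case True
      then have "A = {}" "\<And>c. c \<in> N \<Longrightarrow> \<not> e c \<preceq> m"
        by (auto simp: T_def)
      moreover from this have "lookup (z A) m = 0"
        using deg0 by (auto simp: in_keys_iff)
      ultimately show ?thesis
        unfolding rhs by simp
    next
      case False
      define c0 where "c0 = low T"
      have c0: "c0 \<in> T" "\<And>c. c \<in> T \<Longrightarrow> c \<noteq> c0 \<Longrightarrow> key c0 < key c"
        using low[OF False TN] by (auto simp: c0_def)
      have c0N: "c0 \<in> N"
        using c0 TN by blast
      have small: "\<not> e c \<preceq> m" if "c \<in> N" "key c < key c0" for c
        using c0(2)[of c] that by (force simp: T_def)
      have low_eq: "low B = c0" if "B \<subseteq> T" "c0 \<in> B" for B
      proof (rule ccontr)
        assume ne: "low B \<noteq> c0"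
        have "B \<noteq> {}" "B \<subseteq> N"
          using that TN by auto
        then have "low B \<in> B" "key (low B) < key c0"
          using low(1)[of B] low(2)[of B c0] that ne by auto
        then show False
          using c0(2)[of "low B"] that ne by auto
      qed
      have pos0: "pos key c0 B = 0" if "B \<subseteq> T" for B
      proof -
        have "{r \<in> B. key r < key c0} = {}"
          using c0(2) that by force
        then show ?thesis
          unfolding pos_def by (simp only: card.empty)
      qed
      show ?thesis
      proof (cases "c0 \<in> A")
        case c0A: False
        then have le: "e c0 \<preceq> m"
          using c0(1) by (auto simp: T_def)
        then have sub0: "insert c0 A \<subseteq> T" "insert c0 A \<subseteq> N"
          using c0N A by (auto simp: T_def)
        \<comment> \<open>For \<open>c\<close> other than \<open>c0\<close> the set
          \<open>insert c A\<close> misses \<open>c0\<close>, so its least element is larger while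
          \<open>e c0\<close> still divides the remaining term: the guard in \<open>w\<close> yields
          0, and only the summand of \<open>c0\<close> is left.\<close>
        have "?t c = 0" if c: "c \<in> N - A - {c0}" for c
        proof (cases "e c \<preceq> m")
          case True
          have sub: "insert c A \<subseteq> T" "insert c A \<subseteq> N" "c0 \<notin> insert c A"
            using c True A c0A by (auto simp: T_def)
          have "low (insert c A) \<in> insert c A"
            by (rule low(1)[OF insert_not_empty sub(2)])
          then have "low (insert c A) \<in> T" "low (insert c A) \<noteq> c0"
            using sub by blast+
          then have "key c0 < key (low (insert c A))"
            by (rule c0(2))
          moreover have "e c0 \<preceq> m - e c"
            using le c c0N transfer by blast
          ultimately have "lookup (w (insert c A)) (m - e c) = 0"
            using c0N by (subst w[OF insert_not_empty sub(2)]) (rule if_P, blast)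
          then show ?thesis by simp
        next
          case False
          then show ?thesis by simp
        qed
        then have "(\<Sum>c\<in>N - A. ?t c) = ?t c0"
          using c0N c0A fin sum.mono_neutral_right[of "N - A" "{c0}" ?t] by simp
        moreover have "lookup (w (insert c0 A)) (m - e c0) = lookup (z A) m"
        proof -
          have "\<not> e c \<preceq> m - e c0" if "c \<in> N" "key c < key c0" for c
            using small[OF that] transfer[of c c0] that c0N by blast
          then have "lookup (w (insert c0 A)) (m - e c0) =
              lookup (z (insert c0 A - {c0})) (e c0 + (m - e c0))"
            unfolding w[OF insert_not_empty sub0(2)] low_eq[OF sub0(1) insertI1] by (intro if_not_P) blast
          then show ?thesis
            using le c0A by (simp add: exp_le_imp_add_diff)
        qed
        ultimately show ?thesis
          unfolding rhs using le pos0[OF sub0(1)] by simp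
      next
        case c0A: True
        \<comment> \<open>The cycle condition at \<open>B\<close> is read at the exponent
          \<open>e c0 + m\<close>. Its summand for \<open>c0\<close> is the term of
          \<open>z A\<close>; the others are those of the right side with opposite sign, because
          \<open>c0\<close> precedes each such \<open>c\<close> and shifts its position by
          one.\<close>
        define B where "B = A - {c0}"
        have B: "B \<subseteq> N" "insert c0 B = A" "N - B = insert c0 (N - A)"
          using A c0A c0N by (auto simp: B_def)
        have t: "?t c = - ((-1) ^ pos key c (insert c B) *
            (if e c \<preceq> e c0 + m then lookup (z (insert c B)) (e c0 + m - e c) else 0))"
          if c: "c \<in> N - A" for c
        proof -
          have ne: "c \<noteq> c0" using c c0A by blast
          have "lookup (e c) v \<le> lookup (e c0) v + lookup m v \<longleftrightarrow> lookup (e c) v \<le> lookup m v" for v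
            using disj[of c c0 v] c c0N ne by auto
          then have iff: "e c \<preceq> e c0 + m \<longleftrightarrow> e c \<preceq> m"
            by (simp add: exp_le_def lookup_add)
          show ?thesis
          proof (cases "e c \<preceq> m")
            case True
            have sub: "insert c A \<subseteq> T" "insert c A \<subseteq> N" "c0 \<in> insert c A"
              using c True A c0A by (auto simp: T_def)
            have key: "key c0 < key c"
              using c0(2)[of c] sub(1) ne by blast
            have "\<not> e c' \<preceq> m - e c" if "c' \<in> N" "key c' < key c0" for c'
              using small[OF that] transfer[of c' c] that c key by force
            then have "lookup (w (insert c A)) (m - e c) =
                lookup (z (insert c A - {c0})) (e c0 + (m - e c))"
              unfolding w[OF insert_not_empty sub(2)] low_eq[OF sub(1,3)] by (intro if_not_P) blast
            moreover have "insert c A - {c0} = insert c B"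
              using ne by (auto simp: B_def)
            moreover have "e c0 + (m - e c) = e c0 + m - e c"
              using True by (intro poly_mapping_eqI) (simp add: exp_le_def lookup_add lookup_minus)
            moreover have "pos key c (insert c A) = Suc (pos key c (insert c B))"
            proof -
              have "finite (insert c A)" using A fin finite_subset by blast
              from pos_remove[OF this sub(3), of key c] show ?thesis
                using key calculation(2) by simp
            qed
            ultimately show ?thesis
              using True iff by simp
          next
            case False
            then show ?thesis by (simp add: iff)
          qed
        qed
        have "0 = lookup (\<Sum>c\<in>N - B. (-1) ^ pos key c (insert c B) *
            (Poly_Mapping.single (e c) 1 * z (insert c B))) (e c0 + m)"
          using cycle[OF B(1)] by simp
        also have "\<dots> = (\<Sum>c\<in>N - B. (-1) ^ pos key c (insert c B) *
            (if e c \<preceq> e c0 + m then lookup (z (insert c B)) (e c0 + m - e c) else 0))"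
          unfolding lookup_sum by (intro sum.cong refl) (simp add: lookup_sign_mult lookup_monomial_mult)
        also have "\<dots> = (-1) ^ pos key c0 (insert c0 B) * lookup (z A) m - (\<Sum>c\<in>N - A. ?t c)"
          unfolding B(3) using c0A fin B(2) by (simp add: t sum_negf)
        also have "pos key c0 (insert c0 B) = 0"
          using pos0[of A] B(2) by (simp add: T_def)
        finally show ?thesis
          unfolding rhs by simp
      qed
    qed
  qed
  then have zA: "\<forall>A\<subseteq>N. z A =
        (\<Sum>c\<in>N - A. (-1) ^ pos key c (insert c A) * (Poly_Mapping.single (e c) 1 * w (insert c A)))"
    by (auto intro: poly_mapping_eqI)
  have w0: "w B = 0" if *: "\<forall>c\<in>B. z (B - {c}) = 0" for B
  proof (cases "B = {} \<or> \<not> B \<subseteq> N")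
    case False
    then show ?thesis
      using * low(1)[of B] by (intro poly_mapping_eqI) (simp add: w)
  qed (simp add: w_def)
  have "\<forall>B. (\<forall>c\<in>B. z (B - {c}) = 0) \<longrightarrow> w B = 0"
    using w0 by simp
  with zA show ?thesis
    by (intro exI[of _ w] conjI)
qed

section \<open>Multigraded modules\<close>

lemma multidegree_add: "multidegree (e + k) = multidegree e + multidegree k"
  by (rule poly_mapping_eqI) (simp add: multidegree_def lookup_add Poly_Mapping.map.rep_eq when_def)

lemma multidegree_zero [simp]: "multidegree 0 = 0"
  by (rule poly_mapping_eqI) (simp add: multidegree_def Poly_Mapping.map.rep_eq)

lemma zero_mem_poly_component [simp]: "0 \<in> poly_component a"
  by (simp add: poly_component_def)

lemma one_mem_poly_component: "(1 :: ('v, 'k::field) mpoly) \<in> poly_component 0"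
  by (simp add: poly_component_def)

lemma single_mem_poly_component: "Poly_Mapping.single e c \<in> poly_component (multidegree e)"
  by (simp add: poly_component_def)

lemma add_mem_poly_component:
  "f \<in> poly_component a \<Longrightarrow> g \<in> poly_component a \<Longrightarrow> f + g \<in> poly_component a"
  using keys_add[of f g] by (auto simp: poly_component_def)

lemma mult_mem_poly_component:
  assumes "f \<in> poly_component a" "g \<in> poly_component c"
  shows "f * g \<in> poly_component (a + c)"
  using assms keys_mult[of f g] by (fastforce simp: poly_component_def multidegree_add)

definition homogeneous_component :: "'v multidegree \<Rightarrow> ('v, 'k::field) mpoly \<Rightarrow> ('v, 'k) mpoly" where
  "homogeneous_component a f = Abs_poly_mapping (\<lambda>k. if multidegree k = a then lookup f k else 0)"

lemma lookup_homogeneous_component: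
  "lookup (homogeneous_component a f) k = (if multidegree k = a then lookup f k else 0)"
proof -
  have "finite {k. (if multidegree k = a then lookup f k else 0) \<noteq> 0}"
    by (rule rev_finite_subset[of "keys f"]) (auto simp: in_keys_iff)
  then show ?thesis
    by (simp add: homogeneous_component_def)
qed

lemma homogeneous_component_mem: "homogeneous_component a f \<in> poly_component a"
  by (auto simp: poly_component_def in_keys_iff lookup_homogeneous_component split: if_splits)

lemma homogeneous_component_add:
  "homogeneous_component a (f + g) = homogeneous_component a f + homogeneous_component a g"
  by (rule poly_mapping_eqI) (simp add: lookup_homogeneous_component lookup_add)

lemma homogeneous_component_eq:
  assumes "f \<in> poly_component c"
  shows "homogeneous_component a f = (if a = c then f else 0)"
  using assms
  by (intro poly_mapping_eqI) (auto simp: lookup_homogeneous_component poly_component_def in_keys_iff)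

lemma homogeneous_component_zero [simp]: "homogeneous_component a 0 = 0"
  using homogeneous_component_eq[OF zero_mem_poly_component, of a a] by simp

text \<open>Additive projections settle both halves of the direct sum condition: they provide a
  decomposition, and applying \<open>proj a\<close> to any other one recovers its component of
  degree \<open>a\<close>.\<close>

lemma multigraded_moduleI:
  fixes s :: "('v, 'k::field) mpoly \<Rightarrow> 'm::ab_group_add \<Rightarrow> 'm"
    and proj :: "'v multidegree \<Rightarrow> 'm \<Rightarrow> 'm"
  assumes "module s" and "module.subspace s M"
    and gr: "\<And>a. gr a \<subseteq> M" "\<And>a. 0 \<in> gr a"
      "\<And>a x y. x \<in> gr a \<Longrightarrow> y \<in> gr a \<Longrightarrow> x + y \<in> gr a"
    and scale: "\<And>a c f x. f \<in> poly_component a \<Longrightarrow> x \<in> gr c \<Longrightarrow> s f x \<in> gr (a + c)"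
    and proj_mem: "\<And>a x. x \<in> M \<Longrightarrow> proj a x \<in> gr a"
    and proj_fin: "\<And>x. x \<in> M \<Longrightarrow> finite {a. proj a x \<noteq> 0}"
    and proj_sum: "\<And>x. x \<in> M \<Longrightarrow> (\<Sum>a | proj a x \<noteq> 0. proj a x) = x"
    and proj_add: "\<And>a x y. proj a (x + y) = proj a x + proj a y"
    and proj_eq: "\<And>a c x. x \<in> gr c \<Longrightarrow> proj a x = (if a = c then x else 0)"
  shows "multigraded_module s M gr"
proof -
  have proj_zero: "proj a 0 = 0" for a
    using proj_eq[OF gr(2), of a a] by simp
  have proj_sum': "proj a (sum h A) = (\<Sum>c\<in>A. proj a (h c))" for a A and h :: "'v multidegree \<Rightarrow> 'm"
    by (induction A rule: infinite_finite_induct) (simp_all add: proj_zero proj_add)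
  have "\<exists>!g. (\<forall>a. lookup g a \<in> gr a) \<and> x = (\<Sum>a\<in>keys g. lookup g a)" if x: "x \<in> M" for x
  proof (rule ex1I)
    let ?g = "Abs_poly_mapping (\<lambda>a. proj a x)"
    have l: "lookup ?g = (\<lambda>a. proj a x)"
      using proj_fin[OF x] by simp
    have "keys ?g = {a. proj a x \<noteq> 0}"
      using l by (auto simp: in_keys_iff)
    then show "(\<forall>a. lookup ?g a \<in> gr a) \<and> x = (\<Sum>a\<in>keys ?g. lookup ?g a)"
      using l proj_mem[OF x] proj_sum[OF x] by simp
    fix g
    assume g: "(\<forall>a. lookup g a \<in> gr a) \<and> x = (\<Sum>a\<in>keys g. lookup g a)"
    show "g = ?g"
    proof (rule poly_mapping_eqI)
      fix a
      have "proj a x = (\<Sum>c\<in>keys g. proj a (lookup g c))"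
        using g proj_sum' by metis
      also have "\<dots> = (\<Sum>c\<in>keys g. if a = c then lookup g c else 0)"
        using g proj_eq by (intro sum.cong refl) blast
      also have "\<dots> = lookup g a"
        by (simp add: in_keys_iff)
      finally show "lookup g a = lookup ?g a"
        using l by simp
    qed
  qed
  then show ?thesis
    unfolding multigraded_module_def using assms by blast
qed

subsection \<open>Monomial ideals\<close>

lemma module_times: "module ((*) :: 'r::comm_ring_1 \<Rightarrow> 'r \<Rightarrow> 'r)"
  by unfold_locales (simp_all add: algebra_simps)

text \<open>Multiplication only enlarges exponents, and a term divisible by a generator is a
  multiple of it. Membership thus depends only on the exponents that occur, so selecting the terms
  of one degree stays inside the ideal.\<close>

lemma ideal_generated_monomials:
  "ideal_generated ((\<lambda>e. Poly_Mapping.single e 1) ` A :: ('v, 'k::field) mpoly set) =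
    {f. \<forall>k\<in>keys f. \<exists>e\<in>A. e \<preceq> k}" (is "?I = ?M")
proof -
  interpret module "(*) :: ('v, 'k) mpoly \<Rightarrow> _"
    by (rule module_times)
  have "subspace ?M"
  proof (rule subspaceI)
    fix f g :: "('v, 'k) mpoly" assume "f \<in> ?M" "g \<in> ?M"
    then show "f + g \<in> ?M"
      using keys_add[of f g] by auto
  next
    fix c f :: "('v, 'k) mpoly" assume f: "f \<in> ?M"
    have "\<exists>e\<in>A. e \<preceq> i + k" if "k \<in> keys f" for i k
    proof -
      from f that obtain e where "e \<in> A" "e \<preceq> k"
        by blast
      then show ?thesis
        by (intro bexI[of _ e]) (simp_all add: exp_le_def lookup_add trans_le_add2)
    qed
    then show "c * f \<in> ?M"
      using keys_mult[of c f] by fastforce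
  qed simp
  moreover have "(\<lambda>e. Poly_Mapping.single e 1) ` A \<subseteq> ?M"
    by (auto simp: exp_le_def)
  ultimately have "?I \<subseteq> ?M"
    unfolding ideal_generated_def by (intro span_minimal)
  moreover have "f \<in> ?I" if f: "f \<in> ?M" for f
  proof -
    have "Poly_Mapping.single k (lookup f k) \<in> ?I" if "k \<in> keys f" for k
    proof -
      from f that obtain e where e: "e \<in> A" "e \<preceq> k"
        by blast
      then have "Poly_Mapping.single (k - e) (lookup f k) * Poly_Mapping.single e 1 =
          Poly_Mapping.single k (lookup f k)"
        using exp_le_imp_add_diff[OF e(2)] by (simp add: mult_single add.commute)
      then show ?thesis
        unfolding ideal_generated_def using e(1) by (metis span_scale span_base imageI)
    qed
    then have "(\<Sum>k\<in>keys f. Poly_Mapping.single k (lookup f k)) \<in> ?I"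
      unfolding ideal_generated_def by (intro span_sum)
    then show ?thesis
      by (simp add: sum_monomials)
  qed
  ultimately show ?thesis
    by blast
qed

lemma multigraded_module_monomial_ideal:
  fixes A :: "('v \<Rightarrow>\<^sub>0 nat) set"
  defines "M \<equiv> ideal_generated ((\<lambda>e. Poly_Mapping.single e 1) ` A :: ('v, 'k::field) mpoly set)"
  shows "multigraded_module (*) M (\<lambda>a. M \<inter> poly_component a)"
proof -
  interpret module "(*) :: ('v, 'k) mpoly \<Rightarrow> _"
    by (rule module_times)
  have sub: "subspace M"
    by (simp add: M_def ideal_generated_def)
  have M: "M = {f. \<forall>k\<in>keys f. \<exists>e\<in>A. e \<preceq> k}"
    unfolding M_def by (rule ideal_generated_monomials)
  have fin: "finite {a. homogeneous_component a f \<noteq> 0}" for f :: "('v, 'k) mpoly"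
  proof (rule finite_subset)
    show "{a. homogeneous_component a f \<noteq> 0} \<subseteq> multidegree ` keys f"
    proof
      fix a assume "a \<in> {a. homogeneous_component a f \<noteq> 0}"
      then obtain k where "lookup (homogeneous_component a f) k \<noteq> 0"
        by (auto simp: poly_mapping_eq_iff fun_eq_iff)
      then show "a \<in> multidegree ` keys f"
        by (auto simp: lookup_homogeneous_component in_keys_iff split: if_splits)
    qed
  qed simp
  show ?thesis
  proof (rule multigraded_moduleI[where proj = homogeneous_component])
    show "module ((*) :: ('v, 'k) mpoly \<Rightarrow> _)" "subspace M"
      by (fact module_times sub)+
    show "0 \<in> M \<inter> poly_component a" for a
      using subspace_0[OF sub] by simp
    show "f + g \<in> M \<inter> poly_component a"
      if "f \<in> M \<inter> poly_component a" "g \<in> M \<inter> poly_component a" for a f g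
      using that subspace_add[OF sub] add_mem_poly_component by blast
    show "f * g \<in> M \<inter> poly_component (a + c)"
      if "f \<in> poly_component a" "g \<in> M \<inter> poly_component c" for a c f g
      using that subspace_scale[OF sub] mult_mem_poly_component by blast
    show "homogeneous_component a f \<in> M \<inter> poly_component a" if "f \<in> M" for a f
      using that homogeneous_component_mem[of a f]
      by (auto simp: M in_keys_iff lookup_homogeneous_component split: if_splits)
    show "finite {a. homogeneous_component a f \<noteq> 0}" for f :: "('v, 'k) mpoly"
      by (rule fin)
    show "(\<Sum>a | homogeneous_component a f \<noteq> 0. homogeneous_component a f) = f"
      for f :: "('v, 'k) mpoly"
    proof (rule poly_mapping_eqI)
      fix k
      have "multidegree k \<notin> {a. homogeneous_component a f \<noteq> 0} \<Longrightarrow> lookup f k = 0"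
        using lookup_homogeneous_component[of "multidegree k" f k] by simp
      then show "lookup (\<Sum>a | homogeneous_component a f \<noteq> 0. homogeneous_component a f) k = lookup f k"
        unfolding lookup_sum lookup_homogeneous_component using fin[of f] by auto
    qed
  qed (auto simp: homogeneous_component_add homogeneous_component_eq)
qed

subsection \<open>Free modules\<close>

definition free_on :: "'i set \<Rightarrow> ('i \<Rightarrow>\<^sub>0 'r::zero) set" where
  "free_on I = {x. keys x \<subseteq> I}"

text \<open>The direct sum of shifted copies of the ring over \<open>j \<in> I\<close>, the shift
  placing the basis vector \<open>j\<close> in degree \<open>dg j\<close>.\<close>

definition free_grading ::
  "'i set \<Rightarrow> ('i \<Rightarrow> 'v multidegree) \<Rightarrow> 'v multidegree \<Rightarrow> ('i \<Rightarrow>\<^sub>0 ('v, 'k::field) mpoly) set" where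
  "free_grading I dg a = {x \<in> free_on I. \<forall>j. lookup x j \<in> poly_component (a - dg j)}"

abbreviation basis_vector :: "'i \<Rightarrow> ('i \<Rightarrow>\<^sub>0 'r::comm_ring_1)" where
  "basis_vector j \<equiv> Poly_Mapping.single j 1"

lemma free_onI: "(\<And>j. j \<notin> I \<Longrightarrow> lookup x j = 0) \<Longrightarrow> x \<in> free_on I"
  by (auto simp: free_on_def in_keys_iff)

lemma free_onD: "x \<in> free_on I \<Longrightarrow> j \<notin> I \<Longrightarrow> lookup x j = 0"
  by (auto simp: free_on_def in_keys_iff)

lemma subspace_free_on: "module.subspace free_scale (free_on I)"
proof -
  interpret module free_scale
    by (rule module_free_scale)
  show ?thesis
    by (rule subspaceI) (auto intro!: free_onI simp: free_onD lookup_add)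
qed

lemma is_basis_free_on:
  fixes I :: "'i::finite set"
  shows "is_basis free_scale (free_on I) (basis_vector ` I :: ('i \<Rightarrow>\<^sub>0 'r::comm_ring_1) set)"
proof -
  interpret module "free_scale :: 'r \<Rightarrow> ('i \<Rightarrow>\<^sub>0 'r) \<Rightarrow> _"
    by (rule module_free_scale)
  let ?B = "basis_vector ` I :: ('i \<Rightarrow>\<^sub>0 'r) set"
  have inj: "inj_on (basis_vector :: 'i \<Rightarrow> ('i \<Rightarrow>\<^sub>0 'r)) I"
    by (auto simp: inj_on_def poly_mapping_eq_iff fun_eq_iff lookup_single when_def split: if_splits)
  have "\<not> dependent ?B"
  proof
    assume "dependent ?B"
    then obtain t u v where t: "finite t" "t \<subseteq> ?B" "(\<Sum>v\<in>t. free_scale (u v) v) = 0" "v \<in> t" "u v \<noteq> 0"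
      unfolding dependent_explicit by blast
    from t obtain j where j: "v = basis_vector j" "j \<in> I"
      by blast
    have "0 = lookup (\<Sum>v\<in>t. free_scale (u v) v) j"
      using t by simp
    also have "\<dots> = (\<Sum>v'\<in>t. if v' = v then u v else 0)"
      unfolding lookup_sum
      using t(2) j by (intro sum.cong) (auto simp: lookup_single when_def)
    also have "\<dots> = u v"
      using t by simp
    finally show False
      using t by simp
  qed
  moreover have "span ?B = free_on I"
  proof
    show "span ?B \<subseteq> free_on I"
      by (rule span_minimal[OF _ subspace_free_on]) (auto simp: free_on_def)
    show "free_on I \<subseteq> span ?B"
    proof
      fix x :: "'i \<Rightarrow>\<^sub>0 'r" assume "x \<in> free_on I"
      then have "x = (\<Sum>j\<in>I. free_scale (lookup x j) (basis_vector j))"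
        by (intro poly_mapping_eqI)
          (auto simp: lookup_sum lookup_single when_def free_onD if_distrib[of "(*) _"] cong: if_cong)
      also have "\<dots> \<in> span ?B"
        by (intro span_sum span_scale span_base) simp
      finally show "x \<in> span ?B" .
    qed
  qed
  ultimately show ?thesis
    by (simp add: is_basis_def)
qed

lemma basis_vector_mem_free_grading:
  "j \<in> I \<Longrightarrow> (basis_vector j :: 'i \<Rightarrow>\<^sub>0 ('v, 'k::field) mpoly) \<in> free_grading I dg (dg j)"
  by (auto simp: free_grading_def free_on_def lookup_single when_def one_mem_poly_component)

lemma multigraded_free_module_free_on:
  fixes I :: "'i::finite set" and dg :: "'i \<Rightarrow> 'v multidegree"
  shows "multigraded_free_module (free_scale :: ('v, 'k::field) mpoly \<Rightarrow> _) (free_on I) (free_grading I dg)"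
proof -
  let ?s = "free_scale :: ('v, 'k) mpoly \<Rightarrow> ('i \<Rightarrow>\<^sub>0 ('v, 'k) mpoly) \<Rightarrow> _"
  interpret module ?s
    by (rule module_free_scale)
  define proj :: "'v multidegree \<Rightarrow> ('i \<Rightarrow>\<^sub>0 ('v, 'k) mpoly) \<Rightarrow> _" where
    "proj a x = Abs_poly_mapping (\<lambda>j. homogeneous_component (a - dg j) (lookup x j))" for a x
  have lp: "lookup (proj a x) j = homogeneous_component (a - dg j) (lookup x j)" for a x j
    by (simp add: proj_def)
  have fin: "finite {a. proj a x \<noteq> 0}" for x
  proof (rule finite_subset)
    show "{a. proj a x \<noteq> 0} \<subseteq> (\<Union>j. (\<lambda>k. multidegree k + dg j) ` keys (lookup x j))"
    proof
      fix a assume "a \<in> {a. proj a x \<noteq> 0}"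
      then obtain j k where "lookup (lookup (proj a x) j) k \<noteq> 0"
        by (auto simp: poly_mapping_eq_iff fun_eq_iff)
      then have "multidegree k = a - dg j" "k \<in> keys (lookup x j)"
        by (auto simp: lp lookup_homogeneous_component in_keys_iff split: if_splits)
      then have "a = multidegree k + dg j" "k \<in> keys (lookup x j)"
        by simp_all
      then show "a \<in> (\<Union>j. (\<lambda>k. multidegree k + dg j) ` keys (lookup x j))"
        by blast
    qed
  qed simp
  have "multigraded_module ?s (free_on I) (free_grading I dg)"
  proof (rule multigraded_moduleI[where proj = proj])
    show "module ?s" "subspace (free_on I)"
      by (fact module_free_scale subspace_free_on)+
    show "(free_grading I dg a :: ('i \<Rightarrow>\<^sub>0 ('v, 'k) mpoly) set) \<subseteq> free_on I" for a
      by (auto simp: free_grading_def)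
    show "(0 :: 'i \<Rightarrow>\<^sub>0 ('v, 'k) mpoly) \<in> free_grading I dg a" for a
      by (simp add: free_grading_def free_on_def)
    show "x + y \<in> free_grading I dg a"
      if "x \<in> free_grading I dg a" "y \<in> free_grading I dg a" for a and x y :: "'i \<Rightarrow>\<^sub>0 ('v, 'k) mpoly"
      using that subspace_add[OF subspace_free_on, of x I y]
      by (auto simp: free_grading_def lookup_add add_mem_poly_component)
    show "free_scale f x \<in> free_grading I dg (a + c)"
      if f: "f \<in> poly_component a" and x: "x \<in> free_grading I dg c" for a c f and x :: "'i \<Rightarrow>\<^sub>0 ('v, 'k) mpoly"
    proof -
      have "f * lookup x j \<in> poly_component (a + c - dg j)" for j
      proof -
        have "lookup x j \<in> poly_component (c - dg j)"
          using x by (simp add: free_grading_def)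
        from mult_mem_poly_component[OF f this] show ?thesis
          by (simp add: add_diff_eq)
      qed
      then show ?thesis
        using x subspace_scale[OF subspace_free_on, of x I f] by (auto simp: free_grading_def)
    qed
    show "proj a x \<in> free_grading I dg a" if "x \<in> free_on I" for a and x :: "'i \<Rightarrow>\<^sub>0 ('v, 'k) mpoly"
      unfolding free_grading_def
      using that homogeneous_component_mem by (auto simp: lp free_onD intro!: free_onI)
    show "finite {a. proj a x \<noteq> 0}" for x
      by (rule fin)
    show "(\<Sum>a | proj a x \<noteq> 0. proj a x) = x" for x :: "'i \<Rightarrow>\<^sub>0 ('v, 'k) mpoly"
    proof (intro poly_mapping_eqI)
      fix j k
      let ?a = "multidegree k + dg j"
      have iff: "multidegree k = a - dg j \<longleftrightarrow> a = ?a" for a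
        by (auto simp: algebra_simps)
      have "?a \<notin> {a. proj a x \<noteq> 0} \<Longrightarrow> lookup (lookup x j) k = 0"
        using lp[of ?a x j] lookup_homogeneous_component[of "?a - dg j" "lookup x j" k] by simp
      then show "lookup (lookup (\<Sum>a | proj a x \<noteq> 0. proj a x) j) k = lookup (lookup x j) k"
        unfolding lookup_sum lp lookup_homogeneous_component iff using fin[of x] by auto
    qed
    show "proj a (x + y) = proj a x + proj a y" for a x y
      by (rule poly_mapping_eqI) (simp add: lp lookup_add homogeneous_component_add)
    show "proj a x = (if a = c then x else 0)" if "x \<in> free_grading I dg c" for a c and x :: "'i \<Rightarrow>\<^sub>0 ('v, 'k) mpoly"
    proof (rule poly_mapping_eqI)
      fix j
      have "lookup x j \<in> poly_component (c - dg j)"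
        using that by (simp add: free_grading_def)
      from homogeneous_component_eq[OF this, of "a - dg j"]
      show "lookup (proj a x) j = lookup (if a = c then x else 0) j"
        by (simp add: lp)
    qed
  qed
  then show ?thesis
    unfolding multigraded_free_module_def
    using is_basis_free_on[of I] basis_vector_mem_free_grading[of _ I dg] by blast
qed

lemma multigraded_module_free_on:
  fixes I :: "'i::finite set"
  shows "multigraded_module free_scale (free_on I) (free_grading I dg)"
  using multigraded_free_module_free_on unfolding multigraded_free_module_def by (rule conjunct1)

text \<open>Summing over the whole finite index type lets a single map serve all the submodules
  \<open>free_on I\<close> at once.\<close>

definition linear_extension ::
  "('r::comm_ring_1 \<Rightarrow> 'l::ab_group_add \<Rightarrow> 'l) \<Rightarrow> ('i::finite \<Rightarrow> 'l) \<Rightarrow> ('i \<Rightarrow>\<^sub>0 'r) \<Rightarrow> 'l" where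
  "linear_extension t D x = (\<Sum>j\<in>UNIV. t (lookup x j) (D j))"

lemma linear_extension_module_hom:
  assumes "module t"
  shows "module_hom free_scale t (linear_extension t D)"
proof -
  interpret t: module t by fact
  interpret free: module free_scale by (rule module_free_scale)
  show ?thesis
    by unfold_locales
      (simp_all add: linear_extension_def lookup_add t.scale_left_distrib sum.distrib t.scale_sum_right)
qed

lemma linear_extension_basis_vector:
  assumes "module t"
  shows "linear_extension t D (basis_vector j) = D j"
proof -
  interpret t: module t by fact
  have "t (lookup (basis_vector j) i) (D i) = (if i = j then D j else 0)" for i
    by (simp add: lookup_single when_def)
  then show ?thesis
    by (simp add: linear_extension_def)
qed

lemma multigraded_hom_linear_extension:
  fixes I :: "'i::finite set" and t :: "('v, 'k::field) mpoly \<Rightarrow> 'l::ab_group_add \<Rightarrow> 'l"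
  assumes N: "multigraded_module t N gr'" and D: "\<And>j. j \<in> I \<Longrightarrow> D j \<in> gr' (dg j)"
  shows "multigraded_hom free_scale (free_on I) (free_grading I dg) t N gr' (linear_extension t D)"
proof -
  have t: "module t" and sub: "module.subspace t N"
    and gr: "\<And>a. gr' a \<subseteq> N" "\<And>a. 0 \<in> gr' a" "\<And>a x y. x \<in> gr' a \<Longrightarrow> y \<in> gr' a \<Longrightarrow> x + y \<in> gr' a"
    and scale: "\<And>a c f x. f \<in> poly_component a \<Longrightarrow> x \<in> gr' c \<Longrightarrow> t f x \<in> gr' (a + c)"
    using N unfolding multigraded_module_def by blast+
  interpret t: module t by fact
  interpret h: module_hom free_scale t "linear_extension t D"
    by (rule linear_extension_module_hom[OF t])
  have *: "t (lookup x j) (D j) = 0" if "x \<in> free_on I" "j \<notin> I" for x j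
    using free_onD[OF that] by simp
  have "linear_extension t D x \<in> N" if "x \<in> free_on I" for x
    unfolding linear_extension_def
  proof (rule t.subspace_sum[OF sub])
    fix j
    show "t (lookup x j) (D j) \<in> N"
      using *[OF that, of j] gr(1) D[of j] t.subspace_0[OF sub] t.subspace_scale[OF sub]
      by (cases "j \<in> I") auto
  qed
  moreover have "linear_extension t D x \<in> gr' a" if x: "x \<in> free_grading I dg a" for x a
  proof -
    have sum: "sum h A \<in> gr' a" if "\<And>j. h j \<in> gr' a" for h :: "'i \<Rightarrow> 'l" and A
      by (induction A rule: infinite_finite_induct) (auto simp: gr that)
    show ?thesis
      unfolding linear_extension_def
    proof (rule sum)
      fix j
      show "t (lookup x j) (D j) \<in> gr' a"
      proof (cases "j \<in> I")
        case True
        have "lookup x j \<in> poly_component (a - dg j)"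
          using x by (simp add: free_grading_def)
        from scale[OF this D[OF True]] show ?thesis
          by simp
      next
        case False
        then show ?thesis
          using * x gr(2) by (simp add: free_grading_def)
      qed
    qed
  qed
  ultimately show ?thesis
    unfolding multigraded_hom_def using h.add h.scale by blast
qed

section \<open>Lattices of sets\<close>

locale set_lattice =
  fixes L :: "'n::finite set set"
  assumes Int_mem: "p \<in> L \<Longrightarrow> q \<in> L \<Longrightarrow> p \<inter> q \<in> L"
    and Un_mem: "p \<in> L \<Longrightarrow> q \<in> L \<Longrightarrow> p \<union> q \<in> L"
begin

lemma lower_neighborsD:
  assumes "q \<in> lower_neighbors L p"
  shows "q \<in> L" "q \<subset> p"
  using assms by (auto simp: lower_neighbors_def)

lemma lower_neighbor_maximal:
  assumes "q \<in> lower_neighbors L p" "r \<in> L" "q \<subset> r" "r \<subseteq> p"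
  shows "r = p"
  using assms by (auto simp: lower_neighbors_def)

text \<open>Distinct lower neighbors are incomparable, so the union is a member properly above
  \<open>q\<close>, and no such member lies strictly below \<open>p\<close>.\<close>

lemma lower_neighbors_Un:
  assumes "p \<in> L" "q \<in> lower_neighbors L p" "r \<in> lower_neighbors L p" "q \<noteq> r"
  shows "q \<union> r = p"
proof -
  have qr: "q \<in> L" "r \<in> L" "q \<subset> p" "r \<subset> p"
    using lower_neighborsD[OF assms(2)] lower_neighborsD[OF assms(3)] by blast+
  have "\<not> r \<subset> q"
    using lower_neighbor_maximal[OF assms(3) qr(1)] qr by blast
  then have "q \<subset> q \<union> r"
    using assms(4) by blast
  then show ?thesis
    using lower_neighbor_maximal[OF assms(2) Un_mem[OF qr(1,2)]] qr(3,4) by (simp add: less_imp_le)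
qed

text \<open>As in any modular lattice, union with \<open>r\<close> carries a member strictly between
  \<open>q \<inter> r\<close> and \<open>q\<close> to one strictly between \<open>r\<close> and
  \<open>p\<close>.\<close>

lemma lower_neighbors_Int:
  assumes "p \<in> L" "q \<in> lower_neighbors L p" "r \<in> lower_neighbors L p" "q \<noteq> r"
  shows "q \<inter> r \<in> lower_neighbors L q"
proof -
  have qr: "q \<in> L" "r \<in> L" "q \<subset> p" "r \<subset> p"
    using lower_neighborsD[OF assms(2)] lower_neighborsD[OF assms(3)] by blast+
  have Un: "q \<union> r = p"
    using lower_neighbors_Un[OF assms] .
  have "\<not> (q \<inter> r \<subset> t \<and> t \<subset> q)" if t: "t \<in> L" for t
  proof
    assume *: "q \<inter> r \<subset> t \<and> t \<subset> q"
    then have "r \<subset> t \<union> r" "t \<union> r \<subseteq> p"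
      using qr by blast+
    then have "t \<union> r = p"
      by (intro lower_neighbor_maximal[OF assms(3) Un_mem[OF t qr(2)]])
    then show False
      using * qr by blast
  qed
  moreover have "q \<inter> r \<subset> q"
    using Un qr by blast
  ultimately show ?thesis
    using Int_mem[OF qr(1,2)] by (auto simp: lower_neighbors_def)
qed

lemma lower_neighbor_above:
  assumes "p \<in> L" "r \<in> L" "r \<subset> p"
  shows "\<exists>q\<in>lower_neighbors L p. r \<subseteq> q"
proof -
  define A where "A = {q \<in> L. r \<subseteq> q \<and> q \<subset> p}"
  have "finite A" "A \<noteq> {}"
    using assms by (auto simp: A_def)
  then obtain q where q: "q \<in> A" and max: "\<forall>t\<in>A. q \<subseteq> t \<longrightarrow> q = t"
    using finite_has_maximal by blast
  have "\<not> (q \<subset> t \<and> t \<subset> p)" if "t \<in> L" for t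
    using max that q by (auto simp: A_def)
  moreover have "q \<in> L" "r \<subseteq> q" "q \<subset> p"
    using q by (simp_all add: A_def)
  ultimately show ?thesis
    unfolding lower_neighbors_def by (intro bexI[of _ q]) simp_all
qed

lemma meet_below_eq:
  assumes "S \<subseteq> lower_neighbors L p"
  shows "meet_below p S = p \<inter> \<Inter>S"
proof (cases "S = {}")
  case False
  then obtain r where "r \<in> S"
    by blast
  then have "\<Inter>S \<subseteq> p"
    using lower_neighborsD(2)[of r p] assms by auto
  then show ?thesis
    using False by (simp add: meet_below_def Int_absorb1)
qed (simp add: meet_below_def)

text \<open>Every other \<open>r \<in> S\<close> contains \<open>p - q\<close> because
  \<open>q \<union> r = p\<close>, so the meet removes nothing from \<open>p - q\<close>.\<close>

lemma meet_below_Diff: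
  assumes "p \<in> L" "S \<subseteq> lower_neighbors L p" "q \<in> S"
  shows "meet_below p (S - {q}) - q = p - q"
proof -
  have "p - q \<subseteq> r" if "r \<in> S - {q}" for r
    using lower_neighbors_Un[of p q r] assms that by auto
  moreover have "S - {q} \<subseteq> lower_neighbors L p"
    using assms by blast
  ultimately show ?thesis
    by (auto simp: meet_below_eq)
qed

subsection \<open>The rank function\<close>

text \<open>If some member of \<open>L\<close> contains \<open>i\<close>, this is the smallest such
  member; it is then join-irreducible, a point of the Birkhoff representation. Otherwise the value
  is \<open>UNIV\<close>.\<close>

definition principal_set :: "'n \<Rightarrow> 'n set" where
  "principal_set i = \<Inter>{q \<in> L. i \<in> q}"

lemma mem_principal: "i \<in> principal_set i"
  by (auto simp: principal_set_def)

lemma principal_subset: "p \<in> L \<Longrightarrow> i \<in> p \<Longrightarrow> principal_set i \<subseteq> p"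
  by (auto simp: principal_set_def)

lemma principal_mem:
  assumes "p \<in> L" "i \<in> p"
  shows "principal_set i \<in> L"
proof -
  have *: "\<Inter>A \<in> L" if "finite A" "A \<noteq> {}" "A \<subseteq> L" for A
    using that by (induction rule: finite_ne_induct) (auto intro: Int_mem)
  then show ?thesis
    unfolding principal_set_def using assms by (intro *) auto
qed

text \<open>If \<open>i \<in> p\<close> and \<open>j \<in> q\<close> have the same principal set,
  that set lies in \<open>q\<close> and contains \<open>i\<close>, so
  \<open>i \<in> p \<inter> q\<close>. Images commute with unions in any case, so the number of
  principal sets of points of \<open>p\<close> is a valuation.\<close>

lemma principal_image_Int:
  assumes "p \<in> L" "q \<in> L"
  shows "principal_set ` (p \<inter> q) = principal_set ` p \<inter> principal_set ` q"
proof (intro equalityI subsetI)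
  fix A assume "A \<in> principal_set ` p \<inter> principal_set ` q"
  then obtain i j where ij: "i \<in> p" "A = principal_set i" "j \<in> q" "A = principal_set j"
    by (elim IntE imageE) simp
  then have "i \<in> q"
    using mem_principal[of i] principal_subset[OF assms(2), of j] by auto
  then show "A \<in> principal_set ` (p \<inter> q)"
    using ij by simp
qed (elim imageE, simp)

lemma principal_notin_image:
  assumes "p \<in> L" "i \<notin> p"
  shows "principal_set i \<notin> principal_set ` p"
proof
  assume "principal_set i \<in> principal_set ` p"
  then obtain j where "j \<in> p" "principal_set i = principal_set j"
    by (rule imageE)
  then show False
    using mem_principal[of i] principal_subset[OF assms(1), of j] assms(2) by auto
qed

lemma card_principal_strict_mono:
  assumes "p \<in> L" "q \<in> L" "p \<subset> q"
  shows "card (principal_set ` p) < card (principal_set ` q)"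
proof (rule psubset_card_mono)
  obtain i where i: "i \<in> q" "i \<notin> p"
    using psubset_imp_ex_mem[OF assms(3)] by auto
  show "principal_set ` p \<subset> principal_set ` q"
  proof (rule psubsetI)
    show "principal_set ` p \<subseteq> principal_set ` q"
      using assms(3) by (intro image_mono) simp
    show "principal_set ` p \<noteq> principal_set ` q"
      using principal_notin_image[OF assms(1) i(2)] imageI[OF i(1), of principal_set] by metis
  qed
qed simp

text \<open>For \<open>j \<in> p - q\<close> the union of \<open>principal_set j\<close> with
  \<open>q\<close> is all of \<open>p\<close>, so \<open>principal_set j\<close> contains every
  point of \<open>p - q\<close>. By symmetry these points share one principal set, and a covering
  step adds exactly one.\<close>

lemma card_principal_lower_neighbor:
  assumes "p \<in> L" "q \<in> lower_neighbors L p"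
  shows "card (principal_set ` p) = Suc (card (principal_set ` q))"
proof -
  have q: "q \<in> L" "q \<subset> p"
    using lower_neighborsD[OF assms(2)] by simp_all
  have sub: "principal_set i \<subseteq> principal_set j" if "i \<in> p - q" "j \<in> p - q" for i j
  proof -
    have j: "principal_set j \<in> L"
      using principal_mem[OF assms(1), of j] that by simp
    have "q \<subset> principal_set j \<union> q" "principal_set j \<union> q \<subseteq> p"
      using that q mem_principal[of j] principal_subset[OF assms(1), of j] by auto
    then have "principal_set j \<union> q = p"
      by (rule lower_neighbor_maximal[OF assms(2) Un_mem[OF j q(1)]])
    then have "i \<in> principal_set j"
      using that by auto
    then show ?thesis
      by (rule principal_subset[OF j])
  qed
  obtain i where i: "i \<in> p - q"
    using psubset_imp_ex_mem[OF q(2)] by auto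
  have "principal_set j \<in> {principal_set i}" if "j \<in> p - q" for j
    using sub[OF i that] sub[OF that i] by simp
  then have "principal_set ` (p - q) \<subseteq> {principal_set i}"
    by (rule image_subsetI)
  then have "principal_set ` (p - q) = {principal_set i}"
    using i by blast
  then have "principal_set ` (q \<union> (p - q)) = insert (principal_set i) (principal_set ` q)"
    unfolding image_Un by simp
  moreover have "q \<union> (p - q) = p"
    using q(2) by auto
  moreover have "principal_set i \<notin> principal_set ` q"
    using i principal_notin_image[OF q(1)] by simp
  ultimately show ?thesis
    by simp
qed

text \<open>The rank in a finite distributive lattice counts join-irreducibles. The count strictly
  increases along a chain, which bounds its length; a descent through lower neighbors to
  \<open>{}\<close> loses one per step and attains the bound.\<close>

lemma lattice_rank_eq:
  assumes "{} \<in> L" "p \<in> L"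
  shows "lattice_rank L p = card (principal_set ` p)"
  unfolding lattice_rank_def
proof (rule Max_eqI)
  show "finite {card C - 1 | C. subset.chain L C \<and> p \<in> C \<and> (\<forall>q\<in>C. q \<subseteq> p)}"
    by simp
next
  fix k assume "k \<in> {card C - 1 | C. subset.chain L C \<and> p \<in> C \<and> (\<forall>q\<in>C. q \<subseteq> p)}"
  then obtain C where C: "k = card C - 1" "subset.chain L C" "\<forall>q\<in>C. q \<subseteq> p"
    by blast
  have "inj_on (\<lambda>q. card (principal_set ` q)) C"
  proof (rule inj_onI)
    fix q r assume "q \<in> C" "r \<in> C" and eq: "card (principal_set ` q) = card (principal_set ` r)"
    then have "q \<in> L" "r \<in> L" "q \<subseteq> r \<or> r \<subseteq> q"
      using C(2) by (auto simp: subset_chain_def)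
    then show "q = r"
      using card_principal_strict_mono[of q r] card_principal_strict_mono[of r q] eq by fastforce
  qed
  moreover have "(\<lambda>q. card (principal_set ` q)) ` C \<subseteq> {..card (principal_set ` p)}"
    using C(3) by (auto intro!: card_mono image_mono)
  ultimately have "card C \<le> card {..card (principal_set ` p)}"
    by (intro card_inj_on_le) auto
  then show "k \<le> card (principal_set ` p)"
    using C(1) by simp
next
  have "\<exists>C. subset.chain L C \<and> p \<in> C \<and> (\<forall>q\<in>C. q \<subseteq> p) \<and> card C = Suc (card (principal_set ` p))"
    using assms(2)
  proof (induction "card p" arbitrary: p rule: less_induct)
    case less
    show ?case
    proof (cases "p = {}")
      case True
      then show ?thesis
        using less.prems by (intro exI[of _ "{p}"]) (simp add: subset_chain_def)
    next
      case False
      then obtain q where q: "q \<in> lower_neighbors L p"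
        using lower_neighbor_above[OF less.prems assms(1)] by blast
      note qD = lower_neighborsD[OF q]
      have "card q < card p"
        using qD by (intro psubset_card_mono) auto
      then obtain C where C: "subset.chain L C" "\<forall>r\<in>C. r \<subseteq> q"
          "card C = Suc (card (principal_set ` q))"
        using less.hyps qD by blast
      have "p \<notin> C"
        using C qD by blast
      then have "card (insert p C) = Suc (card (principal_set ` p))"
        using C(3) card_principal_lower_neighbor[OF less.prems q] by simp
      moreover have "subset.chain L (insert p C)"
        using C less.prems qD unfolding subset_chain_def by blast
      ultimately show ?thesis
        using C(2) qD by blast
    qed
  qed
  then obtain C where "subset.chain L C" "p \<in> C" "\<forall>q\<in>C. q \<subseteq> p" "card C = Suc (card (principal_set ` p))"
    by blast
  then show "card (principal_set ` p) \<in> {card C - 1 | C. subset.chain L C \<and> p \<in> C \<and> (\<forall>q\<in>C. q \<subseteq> p)}"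
    by force
qed

text \<open>
  Ties between elements of the same rank are broken by the binary weight of a set. Rank and weight
  are valuations on the lattice, which makes the order compatible with the passage from the lower
  neighbors \<open>r\<close> of \<open>p\<close> to the lower neighbors \<open>q \<inter> r\<close> of \<open>q\<close>.
\<close>

lemma exists_key:
  assumes "{} \<in> L"
  shows "\<exists>key :: 'n set \<Rightarrow> nat. inj_on key L \<and>
    (\<forall>p\<in>L. \<forall>q\<in>L. lattice_rank L p < lattice_rank L q \<longrightarrow> key p < key q) \<and>
    (\<forall>p\<in>L. \<forall>q\<in>L. p \<subset> q \<longrightarrow> key p < key q) \<and>
    (\<forall>p\<in>L. \<forall>q\<in>L. key (p \<union> q) + key (p \<inter> q) = key p + key q)"
proof -
  obtain f :: "'n \<Rightarrow> nat" where f: "inj f"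
    using finite_imp_inj_to_nat_seg[of "UNIV :: 'n set"] by auto
  \<comment> \<open>Distinct powers of two: the binary digits mark the points of \<open>p\<close>,
    so the weight determines \<open>p\<close>; as a sum over points it is modular.\<close>
  define weight where "weight p = (\<Sum>i\<in>p. (2::nat) ^ f i)" for p
  \<comment> \<open>\<open>M\<close> exceeds every weight, so the rank decides first and
    \<open>key p mod M\<close> recovers the weight.\<close>
  define M where "M = Suc (weight UNIV)"
  define key where "key p = card (principal_set ` p) * M + weight p" for p
  have weight_less: "weight p < M" for p
    unfolding M_def weight_def by (simp add: less_Suc_eq_le sum_mono2)
  have weight_eq: "weight p = set_encode (f ` p)" for p
    unfolding weight_def set_encode_def using inj_on_subset[OF f, of p] by (simp add: sum.reindex)
  have less: "key p < key q" if "card (principal_set ` p) < card (principal_set ` q)" for p q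
  proof -
    have "key p < Suc (card (principal_set ` p)) * M"
      using weight_less[of p] by (simp add: key_def)
    also have "\<dots> \<le> key q"
      using that unfolding key_def by (intro trans_le_add1 mult_le_mono1) simp
    finally show ?thesis .
  qed
  have "inj_on key L"
  proof (rule inj_onI)
    fix p q assume "key p = key q"
    then have "weight p = weight q"
      using weight_less unfolding key_def by (metis mod_less mod_mult_self3)
    then have "f ` p = f ` q"
      by (simp add: weight_eq set_encode_eq)
    then show "p = q"
      using f by (simp add: inj_image_eq_iff)
  qed
  moreover have "key (p \<union> q) + key (p \<inter> q) = key p + key q" if "p \<in> L" "q \<in> L" for p q
  proof -
    have "card (principal_set ` (p \<union> q)) + card (principal_set ` (p \<inter> q)) = card (principal_set ` p) + card (principal_set ` q)"
      using principal_image_Int[OF that] card_Un_Int[of "principal_set ` p" "principal_set ` q"]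
      by (simp add: image_Un)
    then have "card (principal_set ` (p \<union> q)) * M + card (principal_set ` (p \<inter> q)) * M =
        card (principal_set ` p) * M + card (principal_set ` q) * M"
      by (metis add_mult_distrib)
    moreover have "weight (p \<union> q) + weight (p \<inter> q) = weight p + weight q"
      unfolding weight_def by (simp add: sum.union_inter)
    ultimately show ?thesis
      by (simp add: key_def)
  qed
  ultimately show ?thesis
    using less card_principal_strict_mono lattice_rank_eq[OF assms] by (intro exI[of _ key]) auto
qed

end

subsection \<open>The lattice of vertex covers\<close>

lemma vertex_cover_iff:
  assumes "bipartite_graph E"
  shows "vertex_cover E C \<longleftrightarrow> (\<forall>i j. {Inl i, Inr j} \<in> E \<longrightarrow> Inl i \<in> C \<or> Inr j \<in> C)"
proof
  assume *: "\<forall>i j. {Inl i, Inr j} \<in> E \<longrightarrow> Inl i \<in> C \<or> Inr j \<in> C"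
  show "vertex_cover E C"
    unfolding vertex_cover_def
  proof
    fix e assume e: "e \<in> E"
    then obtain i j where "e = {Inl i, Inr j}"
      using assms unfolding bipartite_graph_def by blast
    then show "e \<inter> C \<noteq> {}"
      using * e by auto
  qed
next
  assume *: "vertex_cover E C"
  have "Inl i \<in> C \<or> Inr j \<in> C" if "{Inl i, Inr j} \<in> E" for i j
  proof -
    have "{Inl i, Inr j} \<inter> C \<noteq> {}"
      using * that unfolding vertex_cover_def by (rule bspec)
    then show ?thesis by auto
  qed
  then show "\<forall>i j. {Inl i, Inr j} \<in> E \<longrightarrow> Inl i \<in> C \<or> Inr j \<in> C"
    by simp
qed

text \<open>A vertex dropped from \<open>C\<close> is an end of some edge
  \<open>{Inl i, Inr i}\<close> whose other end is not in \<open>C\<close>, so this edge becomes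
  uncovered.\<close>

lemma minimal_vertex_coverI:
  fixes C :: "('n + 'n) set"
  assumes diag: "\<And>i. {Inl i, Inr i} \<in> E"
    and cov: "vertex_cover E C" and C: "\<And>i. Inl i \<notin> C \<or> Inr i \<notin> C"
  shows "minimal_vertex_cover E C"
  unfolding minimal_vertex_cover_def
proof (intro conjI allI impI)
  fix D assume D: "D \<subset> C"
  then obtain v where v: "v \<in> C" "v \<notin> D"
    using psubset_imp_ex_mem by blast
  obtain i where "v = Inl i \<or> v = Inr i"
    by (cases v) auto
  then have "Inl i \<notin> D" "Inr i \<notin> D"
    using v C[of i] D by auto
  then have "{Inl i, Inr i} \<inter> D = {}"
    by simp
  then show "\<not> vertex_cover E D"
    using diag[of i] unfolding vertex_cover_def by blast
qed (fact cov)

text \<open>Unmixedness enters through the minimal cover \<open>range Inl\<close>: every minimal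
  cover has \<open>card UNIV\<close> vertices (for \<open>UNIV\<close> of type
  \<open>'n set\<close>) and, meeting all edges \<open>{Inl i, Inr i}\<close>, contains exactly one
  end of each. Then \<open>j \<in> p\<close> means that \<open>Inr j\<close> is missing, so an edge
  \<open>{Inl i, Inr j}\<close> forces \<open>i \<in> p\<close>.\<close>

lemma cover_lattice_eq:
  fixes E :: "('n::finite + 'n) set set"
  assumes bip: "bipartite_graph E" and unm: "unmixed E" and diag: "\<And>i. {Inl i, Inr i} \<in> E"
  shows "cover_lattice E = {p. \<forall>i j. {Inl i, Inr j} \<in> E \<longrightarrow> j \<in> p \<longrightarrow> i \<in> p}"
proof (intro equalityI subsetI)
  fix p assume "p \<in> cover_lattice E"
  then obtain C where C: "minimal_vertex_cover E C" and p: "p = {i. Inl i \<in> C}"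
    by (auto simp: cover_lattice_def)
  define q where "q = {i. Inr i \<in> C}"
  have cov: "\<And>i j. {Inl i, Inr j} \<in> E \<Longrightarrow> i \<in> p \<or> j \<in> q"
    using C vertex_cover_iff[OF bip, of C] by (simp add: minimal_vertex_cover_def p q_def)
  have "minimal_vertex_cover E (range Inl)"
    by (rule minimal_vertex_coverI[OF diag]) (auto simp: vertex_cover_iff[OF bip])
  then have "card C = card (range (Inl :: 'n \<Rightarrow> 'n + 'n))"
    using unm C unfolding unmixed_def by blast
  also have "\<dots> = card (UNIV :: 'n set)"
    by (simp add: card_image)
  finally have "card C = card (UNIV :: 'n set)" .
  moreover have "C = p <+> q"
  proof (rule set_eqI)
    show "v \<in> C \<longleftrightarrow> v \<in> p <+> q" for v
      by (cases v) (auto simp: p q_def)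
  qed
  then have "card C = card p + card q"
    by (simp only: card_Plus[OF finite finite])
  moreover have "p \<union> q = UNIV"
    using cov diag by auto
  ultimately have "p \<inter> q = {}"
    using card_Un_Int[of p q] by simp
  then show "p \<in> {p. \<forall>i j. {Inl i, Inr j} \<in> E \<longrightarrow> j \<in> p \<longrightarrow> i \<in> p}"
    using cov by auto
next
  fix p assume p: "p \<in> {p. \<forall>i j. {Inl i, Inr j} \<in> E \<longrightarrow> j \<in> p \<longrightarrow> i \<in> p}"
  have "minimal_vertex_cover E (p <+> - p)"
    by (rule minimal_vertex_coverI[OF diag]) (use p in \<open>auto simp: vertex_cover_iff[OF bip]\<close>)
  moreover have "p = {i. Inl i \<in> p <+> - p}"
    by auto
  ultimately show "p \<in> cover_lattice E"
    unfolding cover_lattice_def by blast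
qed

section \<open>The complex\<close>

text \<open>The induction pairs off the summands directly. Comparing the double sum with its own
  negative would only show that twice the sum vanishes, which says nothing in characteristic
  2.\<close>

lemma sum_antisymmetric:
  fixes H :: "'a \<Rightarrow> 'a \<Rightarrow> 'b::ab_group_add"
  assumes "finite S" "\<And>q r. q \<in> S \<Longrightarrow> r \<in> S \<Longrightarrow> q \<noteq> r \<Longrightarrow> H q r = - H r q"
  shows "(\<Sum>q\<in>S. \<Sum>r\<in>S - {q}. H q r) = 0"
  using assms
proof (induction S rule: finite_induct)
  case (insert x S)
  have "(\<Sum>r\<in>insert x S - {q}. H q r) = H q x + (\<Sum>r\<in>S - {q}. H q r)" if "q \<in> S" for q
  proof -
    have "insert x S - {q} = insert x (S - {q})"
      using insert.hyps that by auto
    then show ?thesis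
      using insert.hyps by simp
  qed
  then have "(\<Sum>q\<in>S. \<Sum>r\<in>insert x S - {q}. H q r) = (\<Sum>q\<in>S. H q x)"
    using insert.IH[OF insert.prems] by (simp add: sum.distrib)
  moreover have "(\<Sum>q\<in>S. H q x) = (\<Sum>q\<in>S. - H x q)"
    using insert.prems insert.hyps by (intro sum.cong refl) blast
  moreover have "insert x S - {x} = S"
    using insert.hyps by simp
  ultimately show ?case
    using insert.hyps by (simp add: sum_negf)
qed simp

lemma sign_mult_mem_poly_component:
  "f \<in> poly_component a \<Longrightarrow> (-1) ^ n * f \<in> poly_component a"
  by (auto simp: poly_component_def in_keys_iff lookup_sign_mult)

lemma minus_mem_poly_component: "f \<in> poly_component a \<Longrightarrow> - f \<in> poly_component a"
  by (auto simp: poly_component_def in_keys_iff)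

lemma sqfree_monomial_eq_var_mult:
  assumes "v \<in> A"
  shows "sqfree_monomial A = var v * sqfree_monomial (A - {v})"
proof -
  have "sqfree_exp A = Poly_Mapping.single v 1 + sqfree_exp (A - {v})"
    using assms by (intro poly_mapping_eqI) (auto simp: lookup_add lookup_single when_def)
  then show ?thesis
    by (simp add: var_def mult_single)
qed

section \<open>Lower neighbors in a lattice with a modular key\<close>

locale keyed_lattice = set_lattice L for L :: "'n::finite set set" +
  fixes key :: "'n set \<Rightarrow> nat"
  assumes key_inj: "inj_on key L"
    and key_mono: "p \<in> L \<Longrightarrow> q \<in> L \<Longrightarrow> p \<subset> q \<Longrightarrow> key p < key q"
    and key_modular: "p \<in> L \<Longrightarrow> q \<in> L \<Longrightarrow> key (p \<union> q) + key (p \<inter> q) = key p + key q"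
begin

text \<open>Modularity together with \<open>q \<union> r = p\<close>. For fixed \<open>p\<close> and
  \<open>q\<close>, passing from \<open>r\<close> to \<open>q \<inter> r\<close> shifts keys by a
  constant.\<close>

lemma key_Int:
  assumes "p \<in> L" "q \<in> lower_neighbors L p" "r \<in> lower_neighbors L p" "q \<noteq> r"
  shows "key p + key (q \<inter> r) = key q + key r"
  using key_modular[of q r] lower_neighborsD(1)[OF assms(2)] lower_neighborsD(1)[OF assms(3)]
    lower_neighbors_Un[OF assms] by simp

lemma key_inj_lower_neighbors: "inj_on key (lower_neighbors L p)"
  by (rule inj_on_subset[OF key_inj]) (simp add: lower_neighbors_def)

text \<open>The key of \<open>q \<inter> r\<close> determines that of \<open>r\<close>. Hence
  meeting \<open>S - {q}\<close> with \<open>q\<close> leaves \<open>card S - 1\<close> elements, as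
  the homological degree requires.\<close>

lemma inj_on_Int_lower_neighbors:
  assumes "p \<in> L" "q \<in> lower_neighbors L p"
  shows "inj_on ((\<inter>) q) (lower_neighbors L p - {q})"
proof (rule inj_onI)
  fix r s assume rs: "r \<in> lower_neighbors L p - {q}" "s \<in> lower_neighbors L p - {q}" "q \<inter> r = q \<inter> s"
  then have rs': "r \<in> lower_neighbors L p" "s \<in> lower_neighbors L p" "q \<noteq> r" "q \<noteq> s"
    by auto
  then have "key r = key s"
    using key_Int[OF assms rs'(1,3)] key_Int[OF assms rs'(2,4)] rs(3) by simp
  then show "r = s"
    using inj_onD[OF key_inj_lower_neighbors _ rs'(1,2)] by simp
qed

text \<open>The constant shift in \<open>key_Int\<close> preserves the order of the remaining lower
  neighbors; this is the compatibility on which the signs depend.\<close>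

lemma pos_Int:
  assumes "p \<in> L" "S \<subseteq> lower_neighbors L p" "q \<in> S" "r \<in> S - {q}"
  shows "pos key (q \<inter> r) ((\<inter>) q ` (S - {q})) = pos key r (S - {q})"
proof -
  have q: "q \<in> lower_neighbors L p"
    using assms by auto
  have iff: "key (q \<inter> s) < key (q \<inter> r) \<longleftrightarrow> key s < key r" if "s \<in> S - {q}" for s
  proof -
    have "s \<in> lower_neighbors L p" "q \<noteq> s" "r \<in> lower_neighbors L p" "q \<noteq> r"
      using that assms by auto
    then show ?thesis
      using key_Int[OF assms(1) q, of s] key_Int[OF assms(1) q, of r]
      by (metis nat_add_left_cancel_less)
  qed
  have "{t \<in> (\<inter>) q ` (S - {q}). key t < key (q \<inter> r)} = (\<inter>) q ` {s \<in> S - {q}. key s < key r}"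
    using iff by auto
  moreover have "inj_on ((\<inter>) q) {s \<in> S - {q}. key s < key r}"
    by (rule inj_on_subset[OF inj_on_Int_lower_neighbors[OF assms(1) q]]) (use assms in auto)
  ultimately show ?thesis
    by (simp add: pos_def card_image)
qed

section \<open>The coefficients, the differential and the augmentation\<close>

abbreviation X :: "'n set \<Rightarrow> 'n set \<Rightarrow> ('n + 'n, 'k::field) mpoly" where
  "X p q \<equiv> sqfree_monomial (Inl ` (p - q))"

abbreviation Y :: "'n set \<Rightarrow> 'n set \<Rightarrow> ('n + 'n, 'k::field) mpoly" where
  "Y p q \<equiv> sqfree_monomial (Inr ` (p - q))"

text \<open>Opposite sides of the square \<open>p\<close>, \<open>q\<close>, \<open>r\<close>,
  \<open>q \<inter> r\<close> carry the same monomials, so the coefficients along its two paths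
  agree.\<close>

lemma Diff_Int_lower_neighbors:
  assumes "p \<in> L" "q \<in> lower_neighbors L p" "r \<in> lower_neighbors L p" "q \<noteq> r"
  shows "q - q \<inter> r = p - r"
  using lower_neighbors_Un[OF assms] by auto

definition boundary_basis ::
  "'n set \<times> 'n set set \<Rightarrow> ('n set \<times> 'n set set \<Rightarrow>\<^sub>0 ('n + 'n, 'k::field) mpoly)" where
  "boundary_basis = (\<lambda>(p, S). \<Sum>q\<in>S. free_scale ((-1) ^ pos key q S)
     (free_scale (Y p q) (basis_vector (p, S - {q})) -
      free_scale (X p q) (basis_vector (q, (\<inter>) q ` (S - {q})))))"

text \<open>One linear map on the free module over all pairs, used in every homological degree; the
  degree is carried by the submodules \<open>chains i\<close> alone.\<close>

definition boundary ::
  "('n set \<times> 'n set set \<Rightarrow>\<^sub>0 ('n + 'n, 'k::field) mpoly) \<Rightarrow> ('n set \<times> 'n set set \<Rightarrow>\<^sub>0 ('n + 'n, 'k) mpoly)"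
  where "boundary = linear_extension free_scale boundary_basis"

text \<open>Extended by 0 to the basis elements with \<open>S \<noteq> {}\<close>, so that exactness
  can be stated once for all degrees. The set \<open>p <+> - p\<close> is the vertex cover belonging
  to \<open>p\<close>.\<close>

definition augmentation ::
  "('n set \<times> 'n set set \<Rightarrow>\<^sub>0 ('n + 'n, 'k::field) mpoly) \<Rightarrow> ('n + 'n, 'k) mpoly" where
  "augmentation = linear_extension (*) (\<lambda>(p, S). if S = {} then sqfree_monomial (p <+> - p) else 0)"

text \<open>For lower neighbors the exponent of the required lcm: all \<open>q \<in> S\<close> lie
  below \<open>p\<close>, so the \<open>x\<close>-part is \<open>p\<close>, while the
  \<open>y\<close>-parts unite to the complement of the intersection. For \<open>S = {}\<close> the
  empty intersection is \<open>UNIV\<close>, leaving the exponent of the monomial of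
  \<open>p\<close>.\<close>

definition basis_degree :: "'n set \<times> 'n set set \<Rightarrow> ('n + 'n) \<Rightarrow>\<^sub>0 nat" where
  "basis_degree = (\<lambda>(p, S). sqfree_exp (p <+> - (p \<inter> \<Inter>S)))"

lemma boundary_hom: "module_hom free_scale free_scale boundary"
  unfolding boundary_def by (rule linear_extension_module_hom[OF module_free_scale])

lemma augmentation_hom: "module_hom free_scale (*) augmentation"
  unfolding augmentation_def by (rule linear_extension_module_hom[OF module_times])

lemma boundary_basis_vector: "boundary (basis_vector j) = boundary_basis j"
  unfolding boundary_def by (rule linear_extension_basis_vector[OF module_free_scale])

lemma augmentation_basis_vector:
  "augmentation (basis_vector (p, S)) = (if S = {} then sqfree_monomial (p <+> - p) else 0)"
  unfolding augmentation_def by (simp add: linear_extension_basis_vector[OF module_times])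

lemma basis_index_remove:
  assumes "(p, S) \<in> basis_index L (Suc i)" "q \<in> S"
  shows "(p, S - {q}) \<in> basis_index L i" "(q, (\<inter>) q ` (S - {q})) \<in> basis_index L i"
proof -
  have p: "p \<in> L" and S: "S \<subseteq> lower_neighbors L p" "card S = Suc i"
    using assms(1) by (auto simp: basis_index_def)
  have q: "q \<in> lower_neighbors L p"
    using S assms(2) by auto
  have card: "card (S - {q}) = i"
    using S assms(2) by simp
  then show "(p, S - {q}) \<in> basis_index L i"
    using p S by (auto simp: basis_index_def)
  have "inj_on ((\<inter>) q) (S - {q})"
    by (rule inj_on_subset[OF inj_on_Int_lower_neighbors[OF p q]]) (use S in auto)
  then have "card ((\<inter>) q ` (S - {q})) = i"
    using card by (simp add: card_image)
  moreover have "(\<inter>) q ` (S - {q}) \<subseteq> lower_neighbors L q"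
    using lower_neighbors_Int[OF p q] S by auto
  ultimately show "(q, (\<inter>) q ` (S - {q})) \<in> basis_index L i"
    using lower_neighborsD(1)[OF q] by (simp add: basis_index_def)
qed

text \<open>Homogeneity of both kinds of terms. In the \<open>Y\<close>-term all other
  \<open>r \<in> S\<close> contain \<open>p - q\<close>, so dropping \<open>q\<close> takes exactly
  \<open>p - q\<close> from the \<open>y\<close>-part. In the \<open>X\<close>-term the total
  intersection, hence the \<open>y\<close>-part, is unchanged and the \<open>x\<close>-part shrinks
  from \<open>p\<close> to \<open>q\<close>.\<close>

lemma basis_degree_remove:
  assumes "p \<in> L" "S \<subseteq> lower_neighbors L p" "q \<in> S"
  shows "sqfree_exp (Inr ` (p - q)) + basis_degree (p, S - {q}) = basis_degree (p, S)"
    and "sqfree_exp (Inl ` (p - q)) + basis_degree (q, (\<inter>) q ` (S - {q})) = basis_degree (p, S)"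
proof -
  have qp: "q \<subset> p" and q: "q \<in> lower_neighbors L p"
    using assms lower_neighborsD(2)[of q p] by auto
  have Un: "p - q \<subseteq> r" if "r \<in> S - {q}" for r
    using lower_neighbors_Un[OF assms(1) q, of r] that assms by auto
  have "p <+> - (p \<inter> \<Inter>S) = Inr ` (p - q) \<union> (p <+> - (p \<inter> \<Inter>(S - {q})))"
    using assms(3) by auto
  moreover have "Inr ` (p - q) \<inter> (p <+> - (p \<inter> \<Inter>(S - {q}))) = {}"
    using Un by auto
  ultimately show "sqfree_exp (Inr ` (p - q)) + basis_degree (p, S - {q}) = basis_degree (p, S)"
    by (simp add: basis_degree_def sqfree_exp_Un)
  have "p <+> - (p \<inter> \<Inter>S) = Inl ` (p - q) \<union> (q <+> - (q \<inter> \<Inter>((\<inter>) q ` (S - {q}))))"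
    using assms(3) qp by auto
  moreover have "Inl ` (p - q) \<inter> (q <+> - (q \<inter> \<Inter>((\<inter>) q ` (S - {q})))) = {}"
    by auto
  ultimately show "sqfree_exp (Inl ` (p - q)) + basis_degree (q, (\<inter>) q ` (S - {q})) = basis_degree (p, S)"
    by (simp add: basis_degree_def sqfree_exp_Un)
qed

lemma boundary_basis_mem:
  assumes "j \<in> basis_index L (Suc i)"
  shows "(boundary_basis j :: _ \<Rightarrow>\<^sub>0 ('n + 'n, 'k::field) mpoly) \<in>
    free_grading (basis_index L i) (\<lambda>j. multidegree (basis_degree j)) (multidegree (basis_degree j))"
proof -
  obtain p S where j: "j = (p, S)"
    by (cases j)
  let ?dg = "\<lambda>j. multidegree (basis_degree j)"
  let ?gr = "free_grading (basis_index L i) ?dg ::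
    _ \<Rightarrow> ('n set \<times> 'n set set \<Rightarrow>\<^sub>0 ('n + 'n, 'k) mpoly) set"
  have pS: "p \<in> L" "S \<subseteq> lower_neighbors L p"
    using assms by (auto simp: j basis_index_def)
  have mm: "multigraded_module (free_scale :: ('n + 'n, 'k) mpoly \<Rightarrow> _) (free_on (basis_index L i)) ?gr"
    by (rule multigraded_module_free_on)
  have add: "x + y \<in> ?gr a" if "x \<in> ?gr a" "y \<in> ?gr a" for a x y
    using mm that unfolding multigraded_module_def by blast
  have zero: "0 \<in> ?gr a" for a
    using mm unfolding multigraded_module_def by blast
  have scale: "free_scale f x \<in> ?gr (a + c)" if "f \<in> poly_component a" "x \<in> ?gr c" for a c f x
    using mm that unfolding multigraded_module_def by blast
  have sum: "sum h A \<in> ?gr a" if "\<And>q. q \<in> A \<Longrightarrow> h q \<in> ?gr a"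
    for h :: "'n set \<Rightarrow> _" and A a
    using that by (induction A rule: infinite_finite_induct) (simp_all add: zero add)
  have "free_scale ((-1) ^ n) (free_scale (Y p q) (basis_vector (p, S - {q})) -
      free_scale (X p q) (basis_vector (q, (\<inter>) q ` (S - {q})))) \<in> ?gr (?dg j)" (is "?t \<in> _")
    if q: "q \<in> S" for q n
  proof -
    note idx = basis_index_remove[OF assms[unfolded j] q]
    have "free_scale ((-1) ^ n * Y p q) (basis_vector (p, S - {q})) \<in>
        ?gr (multidegree (sqfree_exp (Inr ` (p - q))) + ?dg (p, S - {q}))"
      by (intro scale sign_mult_mem_poly_component single_mem_poly_component
        basis_vector_mem_free_grading idx)
    moreover have "free_scale (- ((-1) ^ n * X p q)) (basis_vector (q, (\<inter>) q ` (S - {q}))) \<in>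
        ?gr (multidegree (sqfree_exp (Inl ` (p - q))) + ?dg (q, (\<inter>) q ` (S - {q})))"
      by (intro scale minus_mem_poly_component sign_mult_mem_poly_component
        single_mem_poly_component basis_vector_mem_free_grading idx)
    moreover have "?t = free_scale ((-1) ^ n * Y p q) (basis_vector (p, S - {q})) +
        free_scale (- ((-1) ^ n * X p q)) (basis_vector (q, (\<inter>) q ` (S - {q})))"
      by (rule poly_mapping_eqI) (simp add: lookup_minus lookup_add algebra_simps)
    ultimately show ?thesis
      using add basis_degree_remove[OF pS q] by (simp add: j flip: multidegree_add)
  qed
  then show ?thesis
    unfolding j boundary_basis_def by (auto intro!: sum)
qed

section \<open>Vanishing of the composites with the differential\<close>

lemma boundary_basis_Int:
  assumes "p \<in> L" "S \<subseteq> lower_neighbors L p" "q \<in> S"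
  shows "boundary_basis (q, (\<inter>) q ` (S - {q})) =
    (\<Sum>r\<in>S - {q}. free_scale ((-1) ^ pos key r (S - {q}))
      (free_scale (Y p r) (basis_vector (q, (\<inter>) q ` (S - {q, r}))) -
       free_scale (X p r) (basis_vector (q \<inter> r, (\<inter>) (q \<inter> r) ` (S - {q, r})))))"
proof -
  have q: "q \<in> lower_neighbors L p"
    using assms by auto
  have inj: "inj_on ((\<inter>) q) (S - {q})"
    by (rule inj_on_subset[OF inj_on_Int_lower_neighbors[OF assms(1) q]]) (use assms in auto)
  show ?thesis
    unfolding boundary_basis_def prod.case sum.reindex[OF inj] o_def
  proof (intro sum.cong refl)
    fix r assume r: "r \<in> S - {q}"
    have diff: "q - q \<inter> r = p - r"
      using r assms by (intro Diff_Int_lower_neighbors[OF assms(1) q]) auto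
    have "(\<inter>) q ` (S - {q}) - {q \<inter> r} = (\<inter>) q ` (S - {q} - {r})"
      using inj_on_image_set_diff[OF inj, of "S - {q}" "{r}"] r by simp
    also have "S - {q} - {r} = S - {q, r}"
      by auto
    finally have im: "(\<inter>) q ` (S - {q}) - {q \<inter> r} = (\<inter>) q ` (S - {q, r})" .
    have im2: "(\<inter>) (q \<inter> r) ` (\<inter>) q ` (S - {q, r}) = (\<inter>) (q \<inter> r) ` (S - {q, r})"
      unfolding image_image by (intro image_cong refl) auto
    show "free_scale ((-1) ^ pos key (q \<inter> r) ((\<inter>) q ` (S - {q})))
        (free_scale (Y q (q \<inter> r)) (basis_vector (q, (\<inter>) q ` (S - {q}) - {q \<inter> r})) -
         free_scale (X q (q \<inter> r)) (basis_vector (q \<inter> r, (\<inter>) (q \<inter> r) ` ((\<inter>) q ` (S - {q}) - {q \<inter> r})))) =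
      free_scale ((-1) ^ pos key r (S - {q}))
        (free_scale (Y p r) (basis_vector (q, (\<inter>) q ` (S - {q, r}))) -
         free_scale (X p r) (basis_vector (q \<inter> r, (\<inter>) (q \<inter> r) ` (S - {q, r}))))"
      unfolding im im2 diff pos_Int[OF assms r] ..
  qed
qed

lemma boundary_boundary_basis:
  assumes "p \<in> L" "S \<subseteq> lower_neighbors L p"
  shows "boundary (boundary_basis (p, S) :: _ \<Rightarrow>\<^sub>0 ('n + 'n, 'k::field) mpoly) = 0"
proof -
  interpret h: module_hom free_scale free_scale
    "boundary :: (_ \<Rightarrow>\<^sub>0 ('n + 'n, 'k) mpoly) \<Rightarrow> _"
    by (rule boundary_hom)
  define b where "b = (basis_vector :: 'n set \<times> 'n set set \<Rightarrow> (_ \<Rightarrow>\<^sub>0 ('n + 'n, 'k) mpoly))"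
  define x where "x q = (X p q :: ('n + 'n, 'k) mpoly)" for q
  define y where "y q = (Y p q :: ('n + 'n, 'k) mpoly)" for q
  \<comment> \<open>The unsigned contribution of removing \<open>q\<close> and then
    \<open>r\<close>, each by a \<open>Y\<close>-step or an \<open>X\<close>-step. It is symmetric:
    exchanging \<open>q\<close> and \<open>r\<close> swaps the two mixed terms.\<close>
  define G where "G q r = free_scale (y q * y r) (b (p, S - {q, r})) -
      free_scale (y q * x r) (b (r, (\<inter>) r ` (S - {q, r}))) -
      free_scale (x q * y r) (b (q, (\<inter>) q ` (S - {q, r}))) +
      free_scale (x q * x r) (b (q \<inter> r, (\<inter>) (q \<inter> r) ` (S - {q, r})))" for q r
  define H where "H q r = free_scale ((-1) ^ (pos key q S + pos key r (S - {q}))) (G q r)" for q r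
  have set_eq: "S - {q} - {r} = S - {q, r}" for q r
    by auto
  have G_commute: "G q r = G r q" for q r
    by (rule poly_mapping_eqI)
      (simp add: G_def lookup_minus lookup_add insert_commute[of r q] Int_commute[of r q] algebra_simps)
  have H_antisym: "H q r = - H r q" if "q \<in> S" "r \<in> S" "q \<noteq> r" for q r
  proof -
    have "key q \<noteq> key r"
      using that assms inj_onD[OF key_inj_lower_neighbors[of p], of q r] by auto
    \<comment> \<open>The smaller of \<open>q\<close> and \<open>r\<close>, when removed first,
      lowers the position of the other, so the exponents for the two orders of removal differ by
      one.\<close>
    then have "pos key q S + pos key r (S - {q}) = Suc (pos key r S + pos key q (S - {r})) \<or>
        Suc (pos key q S + pos key r (S - {q})) = pos key r S + pos key q (S - {r})"
      using pos_remove[of S q key r] pos_remove[of S r key q] that by auto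
    then have "(-1 :: ('n + 'n, 'k) mpoly) ^ (pos key q S + pos key r (S - {q})) =
        - ((-1) ^ (pos key r S + pos key q (S - {r})))"
      by (elim disjE) (simp, metis power_Suc mult_minus1 minus_minus)
    then show ?thesis
      unfolding H_def G_commute[of q r] by (intro poly_mapping_eqI) simp
  qed
  have "boundary (boundary_basis (p, S)) = boundary (\<Sum>q\<in>S. free_scale ((-1) ^ pos key q S)
      (free_scale (y q) (b (p, S - {q})) - free_scale (x q) (b (q, (\<inter>) q ` (S - {q})))))"
    unfolding b_def x_def y_def by (simp only: boundary_basis_def prod.case)
  also have "\<dots> = (\<Sum>q\<in>S. free_scale ((-1) ^ pos key q S)
      (free_scale (y q) (boundary_basis (p, S - {q})) -
       free_scale (x q) (boundary_basis (q, (\<inter>) q ` (S - {q})))))"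
    by (simp add: h.sum h.scale h.diff boundary_basis_vector b_def)
  also have "\<dots> = (\<Sum>q\<in>S. \<Sum>r\<in>S - {q}. H q r)"
  proof (intro sum.cong refl)
    fix q assume q: "q \<in> S"
    have 1: "boundary_basis (p, S - {q}) = (\<Sum>r\<in>S - {q}. free_scale ((-1) ^ pos key r (S - {q}))
        (free_scale (y r) (b (p, S - {q, r})) - free_scale (x r) (b (r, (\<inter>) r ` (S - {q, r})))))"
      by (simp add: boundary_basis_def set_eq x_def y_def b_def)
    have 2: "boundary_basis (q, (\<inter>) q ` (S - {q})) = (\<Sum>r\<in>S - {q}. free_scale ((-1) ^ pos key r (S - {q}))
        (free_scale (y r) (b (q, (\<inter>) q ` (S - {q, r}))) -
         free_scale (x r) (b (q \<inter> r, (\<inter>) (q \<inter> r) ` (S - {q, r})))))"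
      unfolding boundary_basis_Int[OF assms q] x_def y_def b_def ..
    have 3: "free_scale s (free_scale u (\<Sum>r\<in>A. f r) - free_scale v (\<Sum>r\<in>A. g r)) =
        (\<Sum>r\<in>A. free_scale s (free_scale u (f r) - free_scale v (g r)))"
      for s u v :: "('n + 'n, 'k) mpoly" and A :: "'n set set"
        and f g :: "'n set \<Rightarrow> ('n set \<times> 'n set set \<Rightarrow>\<^sub>0 ('n + 'n, 'k) mpoly)"
      by (simp add: h.m1.scale_sum_right h.m1.scale_right_diff_distrib sum_subtractf)
    show "free_scale ((-1) ^ pos key q S) (free_scale (y q) (boundary_basis (p, S - {q})) -
       free_scale (x q) (boundary_basis (q, (\<inter>) q ` (S - {q})))) = (\<Sum>r\<in>S - {q}. H q r)"
      unfolding 1 2 3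
      by (intro sum.cong refl poly_mapping_eqI)
        (simp add: H_def G_def lookup_minus lookup_add power_add algebra_simps)
  qed
  also have "\<dots> = 0"
    by (rule sum_antisymmetric[OF _ H_antisym]) simp_all
  finally show ?thesis .
qed

text \<open>For \<open>S = {q}\<close> the two monomials multiplied by their coefficients have the
  same exponent; for larger \<open>S\<close> both targets carry a nonempty set, where the
  augmentation is 0.\<close>

lemma augmentation_boundary_basis:
  assumes "p \<in> L" "S \<subseteq> lower_neighbors L p"
  shows "augmentation (boundary_basis (p, S) :: _ \<Rightarrow>\<^sub>0 ('n + 'n, 'k::field) mpoly) = 0"
proof -
  interpret h: module_hom free_scale "(*)"
    "augmentation :: (_ \<Rightarrow>\<^sub>0 ('n + 'n, 'k) mpoly) \<Rightarrow> _"
    by (rule augmentation_hom)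
  have "(-1) ^ pos key q S * (Y p q * augmentation (basis_vector (p, S - {q})) -
      X p q * augmentation (basis_vector (q, (\<inter>) q ` (S - {q})))) = (0 :: ('n + 'n, 'k) mpoly)"
    if q: "q \<in> S" for q
  proof (cases "S - {q} = {}")
    case True
    have qp: "q \<subset> p"
      using q assms lower_neighborsD(2)[of q p] by auto
    have "Inr ` (p - q) \<union> (p <+> - p) = Inl ` (p - q) \<union> (q <+> - q)"
      using qp by auto
    moreover have "Inr ` (p - q) \<inter> (p <+> - p) = {}" "Inl ` (p - q) \<inter> (q <+> - q) = {}"
      by auto
    ultimately have "sqfree_exp (Inr ` (p - q)) + sqfree_exp (p <+> - p) =
        sqfree_exp (Inl ` (p - q)) + sqfree_exp (q <+> - q)"
      by (metis sqfree_exp_Un)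
    then show ?thesis
      using True by (simp add: augmentation_basis_vector mult_single)
  next
    case False
    then show ?thesis
      by (simp only: augmentation_basis_vector image_is_empty if_False) simp
  qed
  then show ?thesis
    unfolding boundary_basis_def prod.case by (simp add: h.sum h.scale h.diff)
qed

abbreviation chains :: "nat \<Rightarrow> ('n set \<times> 'n set set \<Rightarrow>\<^sub>0 ('n + 'n, 'k::field) mpoly) set" where
  "chains i \<equiv> free_on (basis_index L i)"

lemma boundary_eq_sum: "boundary x = (\<Sum>j\<in>UNIV. free_scale (lookup x j) (boundary_basis j))"
  by (simp add: boundary_def linear_extension_def)

text \<open>An arbitrary linear \<open>h\<close> covers both the square of the differential and its
  composite with the augmentation.\<close>

lemma hom_boundary_eq_0:
  assumes "module_hom free_scale t h"
    and "\<And>p S. p \<in> L \<Longrightarrow> S \<subseteq> lower_neighbors L p \<Longrightarrow> h (boundary_basis (p, S)) = 0"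
    and x: "x \<in> chains i"
  shows "h (boundary x) = 0"
proof -
  interpret h: module_hom free_scale t h
    by fact
  have "h (free_scale (lookup x j) (boundary_basis j)) = 0" for j
  proof (cases "j \<in> basis_index L i")
    case True
    then show ?thesis
      using assms(2) by (auto simp: basis_index_def h.scale)
  next
    case False
    then show ?thesis
      using free_onD[OF x] by (simp add: h.scale)
  qed
  then show ?thesis
    by (simp add: boundary_eq_sum h.sum)
qed

lemma multigraded_hom_boundary:
  "multigraded_hom free_scale (chains (Suc i)) (free_grading (basis_index L (Suc i)) (\<lambda>j. multidegree (basis_degree j)))
    free_scale (chains i) (free_grading (basis_index L i) (\<lambda>j. multidegree (basis_degree j)))
    (boundary :: (_ \<Rightarrow>\<^sub>0 ('n + 'n, 'k::field) mpoly) \<Rightarrow> _)"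
  unfolding boundary_def
proof (rule multigraded_hom_linear_extension)
  show "multigraded_module (free_scale :: ('n + 'n, 'k) mpoly \<Rightarrow> _) (chains i)
      (free_grading (basis_index L i) (\<lambda>j. multidegree (basis_degree j)))"
    by (rule multigraded_module_free_on)
qed (rule boundary_basis_mem)

lemma boundary_mem_chains: "x \<in> chains (Suc i) \<Longrightarrow> boundary x \<in> chains i"
  using multigraded_hom_boundary unfolding multigraded_hom_def by blast

subsection \<open>Exactness\<close>

lemma lookup_boundary_basis:
  "lookup (boundary_basis (p', S)) (p, B) = (\<Sum>q\<in>S. (-1) ^ pos key q S *
    (Y p' q * (if p' = p \<and> S - {q} = B then 1 else 0) -
     X p' q * (if q = p \<and> (\<inter>) q ` (S - {q}) = B then 1 else 0)))"
  unfolding boundary_basis_def prod.case lookup_sum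
  by (simp only: lookup_free_scale lookup_minus lookup_single when_def prod.inject)

text \<open>A coefficient at \<open>(p, B)\<close> arises from a \<open>Y\<close>-step out of some
  \<open>(p, insert q B)\<close> or from an \<open>X\<close>-step out of an element having
  \<open>p\<close> as lower neighbor. The hypothesis \<open>above\<close> removes the latter, and
  the Koszul differential of the monomials \<open>Y p q\<close> is left.\<close>

lemma lookup_boundary:
  fixes x :: "_ \<Rightarrow>\<^sub>0 ('n + 'n, 'k::field) mpoly"
  assumes p: "p \<in> L" "B \<subseteq> lower_neighbors L p" and x: "x \<in> chains i"
    and above: "\<And>p' S. p \<in> lower_neighbors L p' \<Longrightarrow> lookup x (p', S) = 0"
  shows "lookup (boundary x) (p, B) = (\<Sum>q\<in>lower_neighbors L p - B.
    (-1) ^ pos key q (insert q B) * (Y p q * lookup x (p, insert q B)))"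
proof -
  let ?f = "\<lambda>j. lookup x j * lookup (boundary_basis j) (p, B)"
  let ?g = "\<lambda>q. (p, insert q B)"
  let ?N = "lower_neighbors L p - B"
  have inj: "inj_on ?g ?N"
    by (rule inj_onI) (metis DiffD2 insertI1 insertE prod.inject)
  have "?f j = 0" if j: "j \<notin> ?g ` ?N" for j
  proof (rule ccontr)
    assume nz: "?f j \<noteq> 0"
    obtain p' S where pS: "j = (p', S)"
      by (cases j)
    have xj: "lookup x (p', S) \<noteq> 0"
      using nz by (auto simp: pS)
    then have S: "S \<subseteq> lower_neighbors L p'"
      using free_onD[OF x, of "(p', S)"] by (auto simp: basis_index_def)
    have "\<exists>q\<in>S. (p' = p \<and> S - {q} = B) \<or> q = p"
    proof (rule ccontr)
      assume no: "\<not> ?thesis"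
      have "lookup (boundary_basis (p', S)) (p, B) = (0 :: ('n + 'n, 'k) mpoly)"
        unfolding lookup_boundary_basis using no by (intro sum.neutral ballI) auto
      then show False
        using nz by (simp add: pS)
    qed
    then obtain q where q: "q \<in> S" "(p' = p \<and> S - {q} = B) \<or> q = p"
      by (elim bexE)
    have "q \<noteq> p"
    proof
      assume "q = p"
      then have "p \<in> lower_neighbors L p'"
        using S q(1) by auto
      then show False
        using above xj by simp
    qed
    then have "p' = p" "B = S - {q}"
      using q(2) by auto
    then have "j = ?g q" "q \<in> ?N"
      using q(1) S by (auto simp: pS)
    then show False
      using j by simp
  qed
  then have "(\<Sum>j\<in>UNIV. ?f j) = (\<Sum>j\<in>?g ` ?N. ?f j)"
    by (intro sum.mono_neutral_right) simp_all
  also have "\<dots> = (\<Sum>q\<in>?N. (-1) ^ pos key q (insert q B) * (Y p q * lookup x (p, insert q B)))"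
    unfolding sum.reindex[OF inj] o_def
  proof (intro sum.cong refl)
    fix q assume q: "q \<in> ?N"
    have "p \<notin> lower_neighbors L p"
      by (simp add: lower_neighbors_def)
    then have np: "p \<notin> insert q B"
      using q p by auto
    have "lookup (boundary_basis (p, insert q B)) (p, B) = (\<Sum>r\<in>insert q B.
        if r = q then (-1) ^ pos key q (insert q B) * Y p q else (0 :: ('n + 'n, 'k) mpoly))"
      unfolding lookup_boundary_basis
    proof (intro sum.cong refl)
      fix r assume r: "r \<in> insert q B"
      then have "insert q B - {r} = B \<longleftrightarrow> r = q" "r \<noteq> p"
        using q np by auto
      then show "(-1) ^ pos key r (insert q B) *
          (Y p r * (if p = p \<and> insert q B - {r} = B then 1 else 0) -
           X p r * (if r = p \<and> (\<inter>) r ` (insert q B - {r}) = B then 1 else 0)) =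
          (if r = q then (-1) ^ pos key q (insert q B) * Y p q else (0 :: ('n + 'n, 'k) mpoly))"
        by simp
    qed
    also have "\<dots> = (-1) ^ pos key q (insert q B) * Y p q"
      by simp
    finally show "lookup x (?g q) * lookup (boundary_basis (?g q)) (p, B) =
        (-1) ^ pos key q (insert q B) * (Y p q * lookup x (p, insert q B))"
      by (simp add: mult_ac)
  qed
  finally show ?thesis
    by (simp add: boundary_eq_sum lookup_sum)
qed

text \<open>Limits what subtracting a boundary can change: starting from \<open>p\<close>, the
  differential reaches only \<open>p\<close> and its lower neighbors, whose keys are
  smaller.\<close>

lemma lookup_boundary_eq_0:
  fixes w :: "_ \<Rightarrow>\<^sub>0 ('n + 'n, 'k::field) mpoly"
  assumes w: "w \<in> chains i" and supp: "\<And>p' S. p' \<noteq> p \<Longrightarrow> lookup w (p', S) = 0"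
    and r: "r \<noteq> p" "r \<notin> lower_neighbors L p"
  shows "lookup (boundary w) (r, A) = 0"
proof -
  have "lookup w j * lookup (boundary_basis j) (r, A) = 0" for j
  proof (cases "lookup w j = 0")
    case False
    obtain p' S where j: "j = (p', S)"
      by (cases j)
    have p': "p' = p"
      using supp[of p' S] False j by auto
    then have "S \<subseteq> lower_neighbors L p"
      using free_onD[OF w, of "(p', S)"] False j by (auto simp: basis_index_def)
    then have "q \<noteq> r" if "q \<in> S" for q
      using r(2) that by auto
    then have "lookup (boundary_basis (p, S)) (r, A) = (0 :: ('n + 'n, 'k) mpoly)"
      unfolding lookup_boundary_basis using r(1) by (intro sum.neutral ballI) simp
    then show ?thesis by (simp add: j p')
  qed simp
  then show ?thesis
    by (simp add: boundary_eq_sum lookup_sum)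
qed

text \<open>A monomial of the coefficient at \<open>b(p; {})\<close>, times \<open>u\<^sub>p\<close>, must cancel against a multiple of some
  \<open>u\<^sub>r\<close> with \<open>p\<close> not below \<open>r\<close>.\<close>

lemma augmentation_top_coefficient:
  fixes x :: "_ \<Rightarrow>\<^sub>0 ('n + 'n, 'k::field) mpoly"
  assumes x: "x \<in> chains i" and aug: "augmentation x = 0"
    and p: "p \<in> L" "\<And>r S. lookup x (r, S) \<noteq> 0 \<Longrightarrow> key r \<le> key p"
    and m: "m \<in> keys (lookup x (p, {}))"
  shows "\<exists>q\<in>lower_neighbors L p. sqfree_exp (Inr ` (p - q)) \<preceq> m"
proof (rule ccontr)
  assume no: "\<not> ?thesis"
  let ?u = "\<lambda>(r, S). if S = {} then sqfree_monomial (r <+> - r) else (0 :: ('n + 'n, 'k) mpoly)"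
  let ?k = "sqfree_exp (p <+> - p) + m"
  have "lookup (lookup x j * ?u j) ?k = (if j = (p, {}) then lookup (lookup x (p, {})) m else 0)" for j
  proof (cases "j = (p, {}) \<or> ?u j = 0 \<or> lookup x j = 0")
    case True
    then show ?thesis
      using lookup_monomial_mult_add[of "sqfree_exp (p <+> - p)" 1 "lookup x (p, {})" m]
      by (auto simp: mult.commute)
  next
    case False
    then obtain r where r: "j = (r, {})" "r \<noteq> p" "lookup x (r, {}) \<noteq> 0"
      by (cases j) (auto split: if_splits)
    then have rL: "r \<in> L"
      using free_onD[OF x, of "(r, {})"] by (auto simp: basis_index_def)
    have "\<not> p \<subset> r"
      using key_mono[OF p(1) rL] p(2)[OF r(3)] by auto
    then have psub: "p \<inter> r \<subset> p"
      using r(2) by auto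
    \<comment> \<open>As \<open>p\<close> is not below \<open>r\<close>, some lower neighbor
      \<open>q\<close> satisfies \<open>p - q \<subseteq> p - r\<close>. The monomial of
      \<open>p\<close> has no \<open>y\<close>-variable with index in \<open>p\<close>, so if that
      of \<open>r\<close> divided the product with \<open>m\<close>, all \<open>y\<close>-variables
      with index in \<open>p - q\<close> would divide \<open>m\<close>.\<close>
    obtain q where q: "q \<in> lower_neighbors L p" "p \<inter> r \<subseteq> q"
      using lower_neighbor_above[OF p(1) Int_mem[OF p(1) rL] psub] by auto
    have "\<not> sqfree_exp (r <+> - r) \<preceq> ?k"
    proof
      assume "sqfree_exp (r <+> - r) \<preceq> ?k"
      then have *: "0 < lookup ?k v" if "v \<in> r <+> - r" for v
        using that by (simp add: sqfree_exp_le_iff)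
      have "0 < lookup m (Inr i)" if "i \<in> p - q" for i
      proof -
        have "Inr i \<in> r <+> - r" "Inr i \<notin> p <+> - p"
          using that q(2) by auto
        then show ?thesis
          using *[of "Inr i"] by (simp add: lookup_add)
      qed
      then have "sqfree_exp (Inr ` (p - q)) \<preceq> m"
        by (auto simp: sqfree_exp_le_iff)
      then show False
        using no q(1) by auto
    qed
    then show ?thesis
      using r lookup_monomial_mult[of "sqfree_exp (r <+> - r)" 1 "lookup x (r, {})" ?k]
      by (simp add: mult.commute)
  qed
  then have "lookup (augmentation x) ?k = lookup (lookup x (p, {})) m"
    by (simp add: augmentation_def linear_extension_def lookup_sum)
  then show False
    using aug m by (simp add: in_keys_iff)
qed

text \<open>One statement serves all degrees: \<open>boundary_chains_0\<close> supplies the first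
  kernel condition in degree 0, \<open>augmentation_chains_Suc\<close> the second one in higher
  degrees.\<close>

lemma exactness:
  assumes "(x :: _ \<Rightarrow>\<^sub>0 ('n + 'n, 'k::field) mpoly) \<in> chains i" "boundary x = 0" "augmentation x = 0"
  shows "x \<in> boundary ` chains (Suc i)"
proof -
  interpret bd: module_hom free_scale free_scale
    "boundary :: (_ \<Rightarrow>\<^sub>0 ('n + 'n, 'k) mpoly) \<Rightarrow> _"
    by (rule boundary_hom)
  interpret aug: module_hom free_scale "(*)"
    "augmentation :: (_ \<Rightarrow>\<^sub>0 ('n + 'n, 'k) mpoly) \<Rightarrow> _"
    by (rule augmentation_hom)
  \<comment> \<open>Induction on a strict bound \<open>k\<close> for the keys in the support; each
    step removes the lattice element of key \<open>k\<close>, unique by injectivity, if there is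
    one.\<close>
  have "x \<in> boundary ` chains (Suc i)"
    if "x \<in> chains i" "boundary x = 0" "augmentation x = 0"
      and "\<And>p S. lookup x (p, S) \<noteq> 0 \<Longrightarrow> key p < k"
    for k and x :: "_ \<Rightarrow>\<^sub>0 ('n + 'n, 'k) mpoly"
    using that
  proof (induction k arbitrary: x)
    case 0
    have "lookup x j = 0" for j
      using 0(4)[of "fst j" "snd j"] by auto
    then have "x = 0"
      by (intro poly_mapping_eqI) simp
    then show ?case
      using bd.zero bd.m1.subspace_0[OF subspace_free_on] by (metis imageI)
  next
    case (Suc k)
    note x = Suc.prems(1)
    show ?case
    proof (cases "\<exists>p\<in>L. key p = k")
      case False
      have "key p < k" if "lookup x (p, S) \<noteq> 0" for p S
      proof -
        have "p \<in> L"
          using free_onD[OF x, of "(p, S)"] that by (auto simp: basis_index_def)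
        then show ?thesis
          using False Suc.prems(4)[OF that] by (auto simp: less_Suc_eq)
      qed
      then show ?thesis
        using Suc by blast
    next
      case True
      then obtain p where p: "p \<in> L" "key p = k"
        by auto
      let ?N = "lower_neighbors L p"
      let ?e = "\<lambda>q. sqfree_exp (Inr ` (p - q)) :: 'n + 'n \<Rightarrow>\<^sub>0 nat"
      have xD: "r \<in> L \<and> S \<subseteq> lower_neighbors L r \<and> card S = i \<and> key r \<le> k" if "lookup x (r, S) \<noteq> 0" for r S
        using free_onD[OF x, of "(r, S)"] that Suc.prems(4)[OF that] by (auto simp: basis_index_def)
      have above: "lookup x (p', S) = 0" if "p \<in> lower_neighbors L p'" for p' S
        using xD[of p' S] key_mono[OF p(1), of p'] lower_neighborsD(2)[OF that] p(2) by force
      have "\<exists>w. (\<forall>A\<subseteq>?N. lookup x (p, A) = (\<Sum>q\<in>?N - A. (-1) ^ pos key q (insert q A) *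
            (Poly_Mapping.single (?e q) 1 * w (insert q A)))) \<and>
          (\<forall>B. (\<forall>q\<in>B. lookup x (p, B - {q}) = 0) \<longrightarrow> w B = 0)"
      proof (rule koszul_exact)
        show "inj_on key ?N"
          by (rule key_inj_lower_neighbors)
        show "lookup (?e q) v = 0 \<or> lookup (?e r) v = 0" if "q \<in> ?N" "r \<in> ?N" "q \<noteq> r" for q r v
          using lower_neighbors_Un[OF p(1) that] by auto
        show "(\<Sum>q\<in>?N - B. (-1) ^ pos key q (insert q B) *
            (Poly_Mapping.single (?e q) 1 * lookup x (p, insert q B))) = 0" if "B \<subseteq> ?N" for B
          using lookup_boundary[OF p(1) that x above] Suc.prems(2) by simp
        show "\<exists>q\<in>?N. ?e q \<preceq> m" if "m \<in> keys (lookup x (p, {}))" for m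
          using xD p(2) by (intro augmentation_top_coefficient[OF x Suc.prems(3) p(1) _ that]) auto
      qed simp
      then obtain w0 where w0': "\<forall>A\<subseteq>?N. lookup x (p, A) = (\<Sum>q\<in>?N - A.
            (-1) ^ pos key q (insert q A) * (Y p q * w0 (insert q A)))"
        and w0_0': "\<forall>B. (\<forall>q\<in>B. lookup x (p, B - {q}) = 0) \<longrightarrow> w0 B = 0"
        by (elim exE conjE) (rule that)
      have w0: "lookup x (p, A) = (\<Sum>q\<in>?N - A.
            (-1) ^ pos key q (insert q A) * (Y p q * w0 (insert q A)))" if "A \<subseteq> ?N" for A
        using w0' that by simp
      have w0_0: "w0 B = 0" if "\<And>q. q \<in> B \<Longrightarrow> lookup x (p, B - {q}) = 0" for B
        using w0_0' that by simp
      define w where "w = Abs_poly_mapping (\<lambda>(p', B). if p' = p \<and> B \<subseteq> ?N then w0 B else 0)"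
      have lw: "lookup w (p', B) = (if p' = p \<and> B \<subseteq> ?N then w0 B else 0)" for p' B
        by (simp add: w_def)
      have w: "w \<in> chains (Suc i)"
      proof (rule free_onI)
        fix j assume j: "j \<notin> basis_index L (Suc i)"
        obtain p' B where pB: "j = (p', B)"
          by (cases j)
        \<comment> \<open>The second clause of \<open>koszul_exact\<close> fixes the homological
          degree: a nonzero \<open>w0 B\<close> needs a nonzero coefficient of \<open>x\<close> at
          some \<open>B - {q}\<close> with \<open>q \<in> B\<close>. That set has \<open>i\<close>
          elements, so \<open>B\<close> has \<open>i + 1\<close>.\<close>
        have "w0 B = 0" if "p' = p" "B \<subseteq> ?N"
        proof (rule w0_0, rule ccontr)
          fix q assume q: "q \<in> B" "lookup x (p, B - {q}) \<noteq> 0"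
          then have "card (B - {q}) = i"
            using xD[of p "B - {q}"] by simp
          then have "card B = Suc i"
            using card_Suc_Diff1[OF finite q(1)] by simp
          then show False
            using j that p(1) by (simp add: pB basis_index_def)
        qed
        then show "lookup w j = 0"
          by (simp add: pB lw)
      qed
      define y where "y = x - boundary w"
      have y: "y \<in> chains i"
        unfolding y_def by (intro bd.m1.subspace_diff[OF subspace_free_on] x boundary_mem_chains w)
      have bw: "boundary (boundary w) = 0"
        by (rule hom_boundary_eq_0[OF boundary_hom boundary_boundary_basis w])
      have aw: "augmentation (boundary w) = 0"
        by (rule hom_boundary_eq_0[OF augmentation_hom augmentation_boundary_basis w])
      have "boundary y = 0" "augmentation y = 0"
        using Suc.prems(2,3) bw aw by (simp_all add: y_def bd.diff aug.diff)
      moreover have "key r < k" if nz: "lookup y (r, A) \<noteq> 0" for r A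
      proof (cases "r = p")
        case True
        have A: "A \<subseteq> ?N"
          using free_onD[OF y, of "(r, A)"] nz True by (auto simp: basis_index_def)
        have "lookup w (p', S) = 0" if "p \<in> lower_neighbors L p'" for p' S
          using lower_neighborsD(2)[OF that] by (auto simp: lw)
        from lookup_boundary[OF p(1) A w this]
        have "lookup (boundary w) (p, A) = (\<Sum>q\<in>?N - A.
            (-1) ^ pos key q (insert q A) * (Y p q * lookup w (p, insert q A)))" .
        also have "\<dots> = lookup x (p, A)"
          unfolding w0[OF A] using A by (intro sum.cong refl) (simp add: lw)
        finally show ?thesis
          using nz True by (simp add: y_def lookup_minus)
      next
        case False
        have r: "r \<in> L"
          using free_onD[OF y, of "(r, A)"] nz by (auto simp: basis_index_def)
        show ?thesis
        proof (cases "r \<in> ?N")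
          case True
          then show ?thesis
            using key_mono[OF r p(1)] lower_neighborsD(2)[OF True] p(2) by simp
        next
          case notN: False
          have "lookup (boundary w) (r, A) = 0"
            by (rule lookup_boundary_eq_0[OF w _ False notN]) (simp add: lw)
          then have "key r \<le> k"
            using xD[of r A] nz by (simp add: y_def lookup_minus)
          moreover have "key r \<noteq> k"
            using inj_onD[OF key_inj _ r p(1)] p(2) False by auto
          ultimately show ?thesis by simp
        qed
      qed
      ultimately have "y \<in> boundary ` chains (Suc i)"
        by (rule Suc.IH[OF y])
      then obtain v where v: "v \<in> chains (Suc i)" "y = boundary v"
        by auto
      have "x = boundary (w + v)"
        using v(2) by (simp add: bd.add y_def algebra_simps)
      then show ?thesis
        using bd.m1.subspace_add[OF subspace_free_on w v(1)] by simp
    qed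
  qed
  \<comment> \<open>There are only finitely many sets, so a bound to start from exists.\<close>
  moreover have "key p < Suc (Max (range key))" for p
    by (simp add: less_Suc_eq_le)
  ultimately show ?thesis
    using assms by blast
qed

subsection \<open>The minimal resolution\<close>

lemma cover_monomial_eq: "cover_monomial p = sqfree_monomial (p <+> - p)"
proof -
  have "Inl ` p \<inter> Inr ` (- p) = {}"
    by auto
  then show ?thesis
    by (simp add: cover_monomial_def prod_var_eq_sqfree_monomial mult_single Plus_def
      sqfree_exp_Un Compl_eq_Diff_UNIV)
qed

lemma cover_ideal_eq:
  "cover_ideal L = ideal_generated ((\<lambda>e. Poly_Mapping.single e 1) ` (\<lambda>p. sqfree_exp (p <+> - p)) ` L)"
  by (simp add: cover_ideal_def cover_monomial_eq image_image)

lemma multigraded_module_cover_ideal: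
  "multigraded_module (*) (cover_ideal L) (\<lambda>a. cover_ideal L \<inter> poly_component a)"
  unfolding cover_ideal_eq by (rule multigraded_module_monomial_ideal)

lemma mem_chains_0: "p \<in> L \<Longrightarrow> basis_vector (p, {}) \<in> chains 0"
  by (rule free_onI) (auto simp: basis_index_def lookup_single when_def)

lemma multigraded_hom_augmentation:
  "multigraded_hom free_scale (chains 0) (free_grading (basis_index L 0) (\<lambda>j. multidegree (basis_degree j)))
    (*) (cover_ideal L) (\<lambda>a. cover_ideal L \<inter> poly_component a)
    (augmentation :: (_ \<Rightarrow>\<^sub>0 ('n + 'n, 'k::field) mpoly) \<Rightarrow> _)"
  unfolding augmentation_def
proof (rule multigraded_hom_linear_extension[OF multigraded_module_cover_ideal])
  fix j assume "j \<in> basis_index L 0"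
  then obtain p where p: "j = (p, {})" "p \<in> L"
    by (auto simp: basis_index_def)
  have "(sqfree_monomial (p <+> - p) :: ('n + 'n, 'k) mpoly) \<in> cover_ideal L"
    using p(2) exp_le_add[of _ 0] unfolding cover_ideal_eq ideal_generated_monomials by auto
  then show "(case j of (p, S) \<Rightarrow> if S = {} then sqfree_monomial (p <+> - p) else 0) \<in>
      cover_ideal L \<inter> (poly_component (multidegree (basis_degree j)) :: ('n + 'n, 'k) mpoly set)"
    using single_mem_poly_component[of "sqfree_exp (p <+> - p)" 1] by (simp add: p(1) basis_degree_def)
qed

lemma augmentation_image:
  "augmentation ` (chains 0 :: (_ \<Rightarrow>\<^sub>0 ('n + 'n, 'k::field) mpoly) set) = cover_ideal L"
proof
  interpret h: module_hom free_scale "(*)"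
    "augmentation :: (_ \<Rightarrow>\<^sub>0 ('n + 'n, 'k) mpoly) \<Rightarrow> _"
    by (rule augmentation_hom)
  show "augmentation ` (chains 0 :: (_ \<Rightarrow>\<^sub>0 ('n + 'n, 'k) mpoly) set) \<subseteq> cover_ideal L"
    using multigraded_hom_augmentation unfolding multigraded_hom_def by (rule conjunct1)
  have "cover_monomial ` L \<subseteq> augmentation ` (chains 0 :: (_ \<Rightarrow>\<^sub>0 ('n + 'n, 'k) mpoly) set)"
  proof
    fix u assume "u \<in> cover_monomial ` L"
    then obtain p where p: "p \<in> L" "u = cover_monomial p"
      by auto
    then have "u = augmentation (basis_vector (p, {}))"
      by (simp add: augmentation_basis_vector cover_monomial_eq)
    then show "u \<in> augmentation ` chains 0"
      using mem_chains_0[OF p(1)] by (rule image_eqI)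
  qed
  then show "cover_ideal L \<subseteq> augmentation ` (chains 0 :: (_ \<Rightarrow>\<^sub>0 ('n + 'n, 'k) mpoly) set)"
    unfolding cover_ideal_def ideal_generated_def
    by (intro h.m2.span_minimal h.subspace_image subspace_free_on)
qed

lemma boundary_chains_0:
  fixes x :: "_ \<Rightarrow>\<^sub>0 ('n + 'n, 'k::field) mpoly"
  assumes "x \<in> chains 0"
  shows "boundary x = 0"
proof -
  have "free_scale (lookup x j) (boundary_basis j) = 0" for j
  proof (cases "j \<in> basis_index L 0")
    case True
    then obtain p where "j = (p, {})"
      by (auto simp: basis_index_def)
    then have "boundary_basis j = (0 :: _ \<Rightarrow>\<^sub>0 ('n + 'n, 'k) mpoly)"
      by (simp add: boundary_basis_def)
    then show ?thesis
      by (intro poly_mapping_eqI) simp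
  next
    case False
    then show ?thesis
      using free_onD[OF assms False] by (intro poly_mapping_eqI) simp
  qed
  then show ?thesis
    by (simp add: boundary_eq_sum)
qed

lemma augmentation_chains_Suc:
  assumes "x \<in> chains (Suc i)"
  shows "augmentation x = 0"
  unfolding augmentation_def linear_extension_def
proof (rule sum.neutral, rule ballI)
  fix j :: "'n set \<times> 'n set set"
  obtain p S where j: "j = (p, S)"
    by (cases j)
  show "lookup x j * (case j of (p, S) \<Rightarrow> if S = {} then sqfree_monomial (p <+> - p) else 0) = 0"
    using free_onD[OF assms, of j] by (auto simp: j basis_index_def)
qed

lemma kernel_augmentation: "{x \<in> chains 0. augmentation x = 0} = boundary ` chains 1"
proof (intro equalityI subsetI)
  fix x assume "x \<in> {x \<in> chains 0. augmentation x = 0}"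
  then show "x \<in> boundary ` chains 1"
    using exactness[of x 0] boundary_chains_0[of x] by simp
next
  fix x assume "x \<in> boundary ` chains 1"
  then obtain w where w: "w \<in> chains (Suc 0)" "x = boundary w"
    by auto
  then show "x \<in> {x \<in> chains 0. augmentation x = 0}"
    using boundary_mem_chains[OF w(1)]
      hom_boundary_eq_0[OF augmentation_hom augmentation_boundary_basis w(1)] by simp
qed

lemma kernel_boundary: "{x \<in> chains (Suc i). boundary x = 0} = boundary ` chains (Suc (Suc i))"
proof (intro equalityI subsetI)
  fix x assume "x \<in> {x \<in> chains (Suc i). boundary x = 0}"
  then show "x \<in> boundary ` chains (Suc (Suc i))"
    using exactness[of x "Suc i"] augmentation_chains_Suc[of x i] by simp
next
  fix x assume "x \<in> boundary ` chains (Suc (Suc i))"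
  then obtain w where w: "w \<in> chains (Suc (Suc i))" "x = boundary w"
    by auto
  then show "x \<in> {x \<in> chains (Suc i). boundary x = 0}"
    using boundary_mem_chains[OF w(1)]
      hom_boundary_eq_0[OF boundary_hom boundary_boundary_basis w(1)] by simp
qed

text \<open>Minimality comes from \<open>q\<close> being a proper subset of \<open>p\<close>: each
  coefficient \<open>X p q\<close> and \<open>Y p q\<close> is divisible by a variable.\<close>

lemma boundary_minimal:
  fixes i :: nat
  defines "F \<equiv> (chains i :: (_ \<Rightarrow>\<^sub>0 ('n + 'n, 'k::field) mpoly) set)"
  shows "boundary ` chains (Suc i) \<subseteq> module.span free_scale {free_scale (var v) x | v x. x \<in> F}"
proof
  interpret module "free_scale :: ('n + 'n, 'k) mpoly \<Rightarrow> ('n set \<times> 'n set set \<Rightarrow>\<^sub>0 ('n + 'n, 'k) mpoly) \<Rightarrow> _"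
    by (rule module_free_scale)
  let ?M = "span {free_scale (var v) x | v x. x \<in> F}"
  have monomial: "free_scale (sqfree_monomial A) (basis_vector j) \<in> ?M"
    if A: "A \<noteq> {}" and j: "j \<in> basis_index L i" for A j
  proof -
    obtain v where v: "v \<in> A"
      using A by auto
    have b: "basis_vector j \<in> F"
      unfolding F_def using j by (intro free_onI) (auto simp: lookup_single when_def)
    have "free_scale (sqfree_monomial A) (basis_vector j :: _ \<Rightarrow>\<^sub>0 ('n + 'n, 'k) mpoly) =
        free_scale (sqfree_monomial (A - {v})) (free_scale (var v) (basis_vector j))"
      by (simp only: sqfree_monomial_eq_var_mult[OF v] scale_scale mult.commute)
    also have "\<dots> \<in> ?M"
      using b by (intro span_scale span_base) auto
    finally show ?thesis .
  qed
  have basis: "boundary_basis j \<in> ?M" if "j \<in> basis_index L (Suc i)" for j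
  proof -
    obtain p S where j: "j = (p, S)"
      by (cases j)
    have "p - q \<noteq> {}" if "q \<in> S" for q
      using \<open>j \<in> basis_index L (Suc i)\<close> that lower_neighborsD(2)[of q p] by (auto simp: j basis_index_def)
    then show ?thesis
      unfolding j boundary_basis_def prod.case
      using basis_index_remove[OF \<open>j \<in> basis_index L (Suc i)\<close>[unfolded j]]
      by (intro span_sum span_scale span_diff monomial) simp_all
  qed
  fix x assume "x \<in> boundary ` (chains (Suc i) :: (_ \<Rightarrow>\<^sub>0 ('n + 'n, 'k) mpoly) set)"
  then obtain w :: "_ \<Rightarrow>\<^sub>0 ('n + 'n, 'k) mpoly" where w: "w \<in> chains (Suc i)" "x = boundary w"
    by auto
  have "free_scale (lookup w j) (boundary_basis j) \<in> ?M" for j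
  proof (cases "j \<in> basis_index L (Suc i)")
    case True
    then show ?thesis
      by (intro span_scale basis)
  next
    case False
    then show ?thesis
      using free_onD[OF w(1) False] by (simp add: span_zero)
  qed
  then show "x \<in> ?M"
    unfolding w(2) boundary_eq_sum by (intro span_sum)
qed

lemma minimal_resolution:
  "minimal_multigraded_free_resolution free_scale
    (chains :: nat \<Rightarrow> (_ \<Rightarrow>\<^sub>0 ('n + 'n, 'k::field) mpoly) set)
    (\<lambda>i. free_grading (basis_index L i) (\<lambda>j. multidegree (basis_degree j)))
    (\<lambda>_. boundary) augmentation (*) (cover_ideal L) (\<lambda>a. cover_ideal L \<inter> poly_component a)"
  unfolding minimal_multigraded_free_resolution_def multigraded_free_resolution_def
  by (intro conjI allI ballI multigraded_module_cover_ideal multigraded_free_module_free_on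
      multigraded_hom_augmentation multigraded_hom_boundary boundary_chains_0 augmentation_image
      kernel_augmentation kernel_boundary boundary_minimal)

section \<open>Multidegrees and coefficients in the form of the statement\<close>

lemma is_lcm_basis_degree:
  assumes "S \<subseteq> lower_neighbors L p"
  shows "is_lcm (cover_monomial ` insert p S :: ('n + 'n, 'k::field) mpoly set)
    (Poly_Mapping.single (basis_degree (p, S)) 1)"
  unfolding is_lcm_def
proof (intro conjI ballI allI impI)
  fix a :: "('n + 'n, 'k) mpoly" assume "a \<in> cover_monomial ` insert p S"
  then obtain r where r: "r \<in> insert p S" "a = sqfree_monomial (r <+> - r)"
    by (auto simp: cover_monomial_eq)
  have "r \<subseteq> p"
    using r(1) assms lower_neighborsD(2)[of r p] by auto
  then have "r <+> - r \<subseteq> p <+> - (p \<inter> \<Inter>S)"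
    using r(1) by auto
  then show "a dvd Poly_Mapping.single (basis_degree (p, S)) 1"
    unfolding r(2) monomial_dvd_iff by (auto simp: sqfree_exp_le_iff basis_degree_def)
next
  fix c :: "('n + 'n, 'k) mpoly" assume c: "\<forall>a\<in>cover_monomial ` insert p S. a dvd c"
  have "0 < lookup k v" if k: "k \<in> keys c" and v: "v \<in> p <+> - (p \<inter> \<Inter>S)" for k v
  proof -
    obtain r where r: "r \<in> insert p S" "v \<in> r <+> - r"
      using v by auto
    have "sqfree_monomial (r <+> - r) dvd c"
      using c r(1) by (auto simp: cover_monomial_eq)
    then have "sqfree_exp (r <+> - r) \<preceq> k"
      using k unfolding monomial_dvd_iff by blast
    then show ?thesis
      using r(2) by (simp add: sqfree_exp_le_iff)
  qed
  then show "Poly_Mapping.single (basis_degree (p, S)) 1 dvd c"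
    unfolding monomial_dvd_iff by (simp add: basis_degree_def sqfree_exp_le_iff)
qed

lemma lattice_basis_basis_vector:
  "lattice_basis L free_scale (chains :: nat \<Rightarrow> (_ \<Rightarrow>\<^sub>0 ('n + 'n, 'k::field) mpoly) set)
    (\<lambda>i. free_grading (basis_index L i) (\<lambda>j. multidegree (basis_degree j)))
    (\<lambda>p S. basis_vector (p, S))"
  unfolding lattice_basis_def
proof (intro conjI allI ballI impI)
  fix i
  have eta: "(\<lambda>(p, S). basis_vector (p, S)) = (basis_vector :: _ \<Rightarrow> (_ \<Rightarrow>\<^sub>0 ('n + 'n, 'k) mpoly))"
    by (simp add: fun_eq_iff)
  show "inj_on (\<lambda>(p, S). basis_vector (p, S) :: _ \<Rightarrow>\<^sub>0 ('n + 'n, 'k) mpoly) (basis_index L i)"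
    unfolding eta
  proof (rule inj_onI)
    fix j l assume "basis_vector j = (basis_vector l :: _ \<Rightarrow>\<^sub>0 ('n + 'n, 'k) mpoly)"
    then have "lookup (basis_vector j :: _ \<Rightarrow>\<^sub>0 ('n + 'n, 'k) mpoly) l = lookup (basis_vector l) l"
      by simp
    then show "j = l"
      by (simp add: lookup_single when_def split: if_splits)
  qed
  show "is_basis free_scale (chains i)
      ((\<lambda>(p, S). basis_vector (p, S) :: _ \<Rightarrow>\<^sub>0 ('n + 'n, 'k) mpoly) ` basis_index L i)"
    unfolding eta by (rule is_basis_free_on)
next
  fix p S assume pS: "p \<in> L" "S \<subseteq> lower_neighbors L p"
  have "(p, S) \<in> basis_index L (card S)"
    using pS by (simp add: basis_index_def)
  from basis_vector_mem_free_grading[OF this]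
  have "(basis_vector (p, S) :: _ \<Rightarrow>\<^sub>0 ('n + 'n, 'k) mpoly) \<in> free_grading (basis_index L (card S))
      (\<lambda>j. multidegree (basis_degree j)) (multidegree (basis_degree (p, S)))" .
  then show "\<exists>e. is_lcm (cover_monomial ` insert p S :: ('n + 'n, 'k) mpoly set) (Poly_Mapping.single e 1) \<and>
      (basis_vector (p, S) :: _ \<Rightarrow>\<^sub>0 ('n + 'n, 'k) mpoly) \<in> free_grading (basis_index L (card S))
        (\<lambda>j. multidegree (basis_degree j)) (multidegree e)"
    using is_lcm_basis_degree[OF pS(2)] by (intro exI conjI)
qed

text \<open>The relation induced by \<open>key\<close> turns \<open>position\<close> into
  \<open>pos\<close>, and \<open>meet_below_Diff\<close> turns \<open>Y_coeff p S q\<close> into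
  \<open>Y p q\<close>.\<close>

lemma boundary_formula:
  assumes "p \<in> L" "S \<subseteq> lower_neighbors L p"
  shows "boundary (basis_vector (p, S) :: _ \<Rightarrow>\<^sub>0 ('n + 'n, 'k::field) mpoly) =
    (\<Sum>q\<in>S. free_scale ((-1) ^ position {(p, q). key p < key q} q S)
      (free_scale (Y_coeff p S q) (basis_vector (p, S - {q})) -
       free_scale (X_coeff p q) (basis_vector (q, (\<lambda>r. q \<inter> r) ` (S - {q})))))"
proof -
  have "(Y_coeff p S q :: ('n + 'n, 'k) mpoly) = Y p q" if "q \<in> S" for q
    using meet_below_Diff[OF assms that] by (simp add: Y_coeff_def prod_var_eq_sqfree_monomial)
  moreover have "(X_coeff p q :: ('n + 'n, 'k) mpoly) = X p q" for q
    by (simp add: X_coeff_def prod_var_eq_sqfree_monomial)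
  ultimately show ?thesis
    unfolding boundary_basis_vector boundary_basis_def prod.case
    by (intro sum.cong refl) (simp add: position_def pos_def)
qed

end

theorem theorem1p3:
  fixes E :: "('n::finite + 'n) set set"
  assumes "bipartite_graph E"
    and "unmixed E"
    and "\<And>i. {Inl i, Inr i} \<in> E"
  shows "\<exists>ord. total_extension_of_rank (cover_lattice E) ord \<and>
    (\<exists>(F :: nat \<Rightarrow> (('n set \<times> 'n set set) \<Rightarrow>\<^sub>0 ('n + 'n, 'k::field) mpoly) set) gr d \<epsilon> b.
      minimal_multigraded_free_resolution free_scale F gr d \<epsilon>
        (*) (cover_ideal (cover_lattice E)) (\<lambda>a. cover_ideal (cover_lattice E) \<inter> poly_component a) \<and>
      lattice_basis (cover_lattice E) free_scale F gr b \<and>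
      (\<forall>p\<in>cover_lattice E. \<forall>S\<subseteq>lower_neighbors (cover_lattice E) p.
        d (card S) (b p S) =
          (\<Sum>q\<in>S. free_scale ((-1) ^ position ord q S)
             (free_scale (Y_coeff p S q) (b p (S - {q})) -
              free_scale (X_coeff p q) (b q ((\<lambda>r. q \<inter> r) ` (S - {q})))))))"
proof -
  let ?L = "cover_lattice E"
  note L = cover_lattice_eq[OF assms]
  \<comment> \<open>Sets closed under implications between points are stable under unions and
    intersections.\<close>
  interpret lat: set_lattice ?L
    by unfold_locales (auto simp: L)
  have "{} \<in> ?L"
    by (simp add: L)
  from lat.exists_key[OF this] obtain key :: "'n set \<Rightarrow> nat" where key: "inj_on key ?L"
      "\<forall>p\<in>?L. \<forall>q\<in>?L. lattice_rank ?L p < lattice_rank ?L q \<longrightarrow> key p < key q"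
      "\<forall>p\<in>?L. \<forall>q\<in>?L. p \<subset> q \<longrightarrow> key p < key q"
      "\<forall>p\<in>?L. \<forall>q\<in>?L. key (p \<union> q) + key (p \<inter> q) = key p + key q"
    by (elim exE conjE) (rule that)
  interpret keyed_lattice ?L key
    by unfold_locales (use key in \<open>simp_all\<close>)
  \<comment> \<open>Transitive and irreflexive on all sets; totality holds on the lattice, where
    \<open>key\<close> is injective.\<close>
  let ?ord = "{(p, q). key p < key q}"
  have "total_on ?L ?ord"
  proof (rule total_onI)
    fix p q assume "p \<in> ?L" "q \<in> ?L" "p \<noteq> q"
    then have "key p \<noteq> key q"
      using inj_onD[OF key(1)] by blast
    then show "(p, q) \<in> ?ord \<or> (q, p) \<in> ?ord"
      by auto
  qed
  moreover have "trans ?ord" "irrefl ?ord"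
    by (auto simp: trans_def irrefl_def)
  ultimately have "total_extension_of_rank ?L ?ord"
    using key(2) by (simp add: total_extension_of_rank_def strict_linear_order_on_def)
  then show ?thesis
    using minimal_resolution lattice_basis_basis_vector boundary_formula
    by (intro exI[of _ ?ord] conjI exI[of _ chains]
        exI[of _ "\<lambda>i. free_grading (basis_index ?L i) (\<lambda>j. multidegree (basis_degree j))"]
        exI[of _ "\<lambda>_. boundary"] exI[of _ augmentation] exI[of _ "\<lambda>p S. basis_vector (p, S)"] ballI allI impI)
qed

end
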